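(* Let $f\in L_{2\pi}$ be a complex-valued function with Fourier coefficients $\hat f(n)$, $n\in\mathbb{Z}$. Suppose that $\{\hat f(n)\}_{n=0}^{+\infty}\in MVBVS$ and that $$\lim_{\mu\to 1^+}\limsup_{n\to\infty}\sum_{k=n}^{[\mu n]}\left|\Delta\hat f(k)-\Delta\hat f(-k)\right|\log k=0,$$ where $\Delta\hat f(k)=\hat f(k+1)-\hat f(k)$ and $\Delta\hat f(-k)=\hat f(-k-1)-\hat f(-k)$ for $k\ge 0$. Then $$\lim_{n\to\infty}\|f-S_n(f)\|_L=0\quad\text{if and only if}\quad \lim_{|n|\to\infty}\hat f(n)\log|n|=0.$$
   Context: $L_{2\pi}$ is the space of complex-valued integrable functions of period $2\pi$ with norm $\|f\|_L=\int_{-\pi}^{\pi}|f(x)|\,dx$. The Fourier coefficients of $f$ are $\hat f(k)=\frac1{2\pi}\int_{-\pi}^{\pi}f(x)e^{-ikx}\,dx$, $k\in\mathbb{Z}$, and the partial sums are $S_n(f,x)=\sum_{k=-n}^{n}\hat f(k)e^{ikx}$. $[x]$ denotes the integer part of $x$. For $\theta\in[0,\pi/2)$ let $K(\theta)=\{z\in\mathbb{C}:|\arg z|\le\theta\}$ (with $0\in K(\theta)$). A complex sequence $\mathbf{c}=\{c_n\}_{n=0}^\infty$ belongs to $MVBVS$ (mean value bounded variation sequences) if there is some $\theta_1\in[0,\pi/2)$ with $c_n\in K(\theta_1)$ for all $n\ge 0$, and there are a number $\lambda\ge2$ and a positive constant $C(\mathbf{c})$ depending only on the sequence such that $$\sum_{k=m}^{2m}|c_{k+1}-c_k|\le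 \frac{C(\mathbf{c})}{m}\sum_{k=[\lambda^{-1}m]}^{[\lambda m]}|c_k|\qquad\text{for all } m=1,2,\dots.$$ *)

theory Defs
  imports "HOL-Analysis.Analysis"
begin

definition L_2pi :: "(real \<Rightarrow> complex) set" where
  "L_2pi = {f. (\<forall>x. f (x + 2 * pi) = f x) \<and> set_integrable lebesgue {-pi..pi} f}"

definition L_norm :: "(real \<Rightarrow> complex) \<Rightarrow> real" where
  "L_norm f = (LINT x:{-pi..pi}|lebesgue. cmod (f x))"

definition fourier_coeff :: "(real \<Rightarrow> complex) \<Rightarrow> int \<Rightarrow> complex" where
  "fourier_coeff f k =
     1 / (2 * of_real pi) *
       (LINT x:{-pi..pi}|lebesgue. f x * exp (- \<i> * of_int k * of_real x))"

definition fourier_partial_sum :: "nat \<Rightarrow> (real \<Rightarrow> complex) \<Rightarrow> real \<Rightarrow> complex" where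
  "fourier_partial_sum n f x =
     (\<Sum>k\<in>{- int n..int n}. fourier_coeff f k * exp (\<i> * of_int k * of_real x))"

definition sector :: "real \<Rightarrow> complex set" where
  "sector \<theta> = {z. z = 0 \<or> \<bar>Arg z\<bar> \<le> \<theta>}"

definition MVBVS :: "(nat \<Rightarrow> complex) set" where
  "MVBVS = {c.
     (\<exists>\<theta>. 0 \<le> \<theta> \<and> \<theta> < pi / 2 \<and> (\<forall>n. c n \<in> sector \<theta>)) \<and>
     (\<exists>lam::real. \<exists>C::real. lam \<ge> 2 \<and> C > 0 \<and>
       (\<forall>m::nat. m \<ge> 1 \<longrightarrow>
         (\<Sum>k=m..2 * m. cmod (c (k + 1) - c k))
           \<le> C / real m *
               (\<Sum>k=nat \<lfloor>real m / lam\<rfloor>..nat \<lfloor>lam * real m\<rfloor>. cmod (c k))))}"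

end

theory Submission
  imports Defs
begin

text \<open>
  Write \<open>a n\<close> and \<open>b n\<close> for the Fourier coefficients of \<open>f\<close> at \<open>n\<close> and \<open>-n\<close>, \<open>d = a - b\<close>, and
  \<open>S n\<close> for the partial sums. The limsup hypothesis says that the variation of \<open>d\<close> over
  \<open>[n, \<mu> n]\<close>, multiplied by \<open>log n\<close>, is small when \<open>\<mu>\<close> is close to \<open>1\<close> and \<open>n\<close> is large
  (\<open>slowly_varying\<close>).

  Convergence forces decay. The sums \<open>\<Sum>j\<le>J. sin (j x) / j\<close> are bounded uniformly in \<open>J\<close> and \<open>x\<close>.
  Pairing \<open>f - S n\<close>, whose coefficients vanish on \<open>[-n, n]\<close>, with such a sum shifted to frequency
  \<open>n\<close> or \<open>-n\<close> isolates one half of it: \<open>\<Sum>j\<le>J. a (n + j) / j\<close> and \<open>\<Sum>j\<le>J. b (n + j) / j\<close> are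
  bounded by the norm of \<open>f - S n\<close> for \<open>J \<le> n\<close> (\<open>coeff_tail_sums_bounded\<close>). Since \<open>a\<close> lies in a
  sector, absolute values may be put inside the sums of \<open>a\<close>. Adding these sums over \<open>n\<close> counts each
  \<open>|a k|\<close> about \<open>log k\<close> times, so the averages of \<open>|a k| log k\<close> over \<open>[m / \<lambda>, \<lambda> m]\<close> tend to \<open>0\<close>,
  and the MVBV inequality turns this decay in the mean into \<open>a n log n \<longlonglongrightarrow> 0\<close>
  (\<open>MVBVS_log_null\<close>). The sequence \<open>d\<close> has no sign, but it is almost constant on \<open>[n, \<mu> n]\<close>, so
  \<open>\<Sum>j\<le>J. d (n + j) / j\<close> with \<open>J = (\<mu> - 1) n\<close> is close to \<open>d n\<close> times a harmonic number of
  order \<open>log n\<close> (\<open>slowly_varying_log_null\<close>); hence \<open>b = a - d\<close> decays as well.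

  Decay forces convergence. Averages of \<open>S m\<close> over \<open>n \<le> m < M\<close> with \<open>M\<close> about \<open>\<mu> n\<close> converge to
  \<open>f\<close> in norm for every integrable \<open>f\<close> (\<open>vallee_poussin_means\<close>), so it suffices that
  \<open>S m - S n\<close> is small for \<open>n \<le> m \<le> \<mu> n\<close> (\<open>L1_convergence_of_slow_partial_sums\<close>). A sum of
  exponentials over a block of frequencies up to \<open>m\<close> has norm \<open>O(log m)\<close>, so summation by parts
  bounds \<open>S m - S n\<close> by \<open>log m\<close> times the last coefficients and the variations of \<open>a\<close> and \<open>b\<close> over
  the block (\<open>block_L1\<close>). The variation of \<open>a\<close> is controlled by the MVBV inequality, and that of
  \<open>b\<close> by those of \<open>a\<close> and \<open>d\<close> (\<open>partial_sums_slow\<close>).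
\<close>

section \<open>Integration over one period\<close>

abbreviation circ :: "real measure" where
  "circ \<equiv> lebesgue_on {-pi..pi}"

lemma circ_finite: "finite_measure circ"
  by (rule finite_measure_lebesgue_on) (simp add: lmeasurable_cbox[of "-pi" pi, simplified])

lemma L_norm_eq: "L_norm g = (\<integral>x. cmod (g x) \<partial>circ)"
  unfolding L_norm_def set_lebesgue_integral_def
  by (subst integral_restrict_space) auto

lemma fourier_coeff_eq:
  "fourier_coeff g k = (\<integral>x. g x * cis (- (of_int k * x)) \<partial>circ) / (2 * of_real pi)"
  unfolding fourier_coeff_def set_lebesgue_integral_def
  by (subst integral_restrict_space) (auto simp: cis_conv_exp mult_ac)

lemma fourier_partial_sum_eq:
  "fourier_partial_sum n g x = (\<Sum>k\<in>{- int n..int n}. fourier_coeff g k * cis (of_int k * x))"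
  unfolding fourier_partial_sum_def by (simp add: cis_conv_exp mult_ac)

lemma L_2pi_integrable: "f \<in> L_2pi \<Longrightarrow> integrable circ f"
  unfolding L_2pi_def set_integrable_def by (auto simp: integrable_restrict_space)

lemma measurable_continuous_circ [measurable (raw)]:
  fixes g :: "real \<Rightarrow> 'b::euclidean_space"
  assumes "continuous_on UNIV g"
  shows "g \<in> borel_measurable circ"
  by (rule continuous_imp_measurable_on_sets_lebesgue)
     (auto intro: continuous_on_subset[OF assms])

lemma measurable_cis [measurable]: "(\<lambda>x. cis (c * x)) \<in> borel_measurable circ"
  by (intro measurable_continuous_circ continuous_intros)

lemma integrable_bounded_mult:
  fixes g h :: "real \<Rightarrow> complex"
  assumes "integrable circ g" "h \<in> borel_measurable circ" "\<And>x. cmod (h x) \<le> B"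
  shows "integrable circ (\<lambda>x. g x * h x)"
proof (rule Bochner_Integration.integrable_bound)
  show "integrable circ (\<lambda>x. B * cmod (g x))" using assms by auto
  show "(\<lambda>x. g x * h x) \<in> borel_measurable circ"
    using assms by auto
  show "AE x in circ. cmod (g x * h x) \<le> norm (B * cmod (g x))"
  proof (rule AE_I2)
    fix x
    have "cmod (h x) * cmod (g x) \<le> B * cmod (g x)"
      by (intro mult_right_mono assms) auto
    then show "cmod (g x * h x) \<le> norm (B * cmod (g x))"
      by (simp add: norm_mult mult.commute)
  qed
qed

lemma integrable_bounded:
  fixes h :: "real \<Rightarrow> 'b::{banach,second_countable_topology}"
  assumes "h \<in> borel_measurable circ" "\<And>x. norm (h x) \<le> B"
  shows "integrable circ h"
  by (rule finite_measure.integrable_const_bound[OF circ_finite, where B=B]) (use assms in auto)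

lemma integrable_cis [simp]: "integrable circ (\<lambda>x. cis (c * x))"
  by (rule integrable_bounded[where B=1]) auto

lemma integrable_mult_cis [simp]:
  "integrable circ g \<Longrightarrow> integrable circ (\<lambda>x. g x * cis (c * x))"
  by (rule integrable_bounded_mult[where B=1]) auto

lemma integrable_mult_cis_minus [simp]:
  "integrable circ g \<Longrightarrow> integrable circ (\<lambda>x. g x * cis (- (c * x)))"
  using integrable_mult_cis[of g "-c"] by simp

lemma measure_circ: "measure circ {-pi..pi} = 2 * pi"
  by (simp add: measure_restrict_space)

lemma integral_cis: "(\<integral>x. cis (of_int k * x) \<partial>circ) = (if k = 0 then 2 * of_real pi else 0)"
proof (cases "k = 0")
  case True
  then show ?thesis using measure_circ by (simp add: scaleR_conv_of_real)
next
  case False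
  have "((\<lambda>x. cis (of_int k * x)) has_integral
      cis (of_int k * pi) / (\<i> * of_int k) - cis (of_int k * (-pi)) / (\<i> * of_int k)) {-pi..pi}"
  proof (rule fundamental_theorem_of_calculus)
    fix x :: real
    have "((\<lambda>z. exp (\<i> * of_int k * z) / (\<i> * of_int k)) has_field_derivative exp (\<i> * of_int k * of_real x)) (at (of_real x))"
      using False by (auto intro!: derivative_eq_intros)
    from has_vector_derivative_real_field[OF this]
    show "((\<lambda>x. cis (of_int k * x) / (\<i> * of_int k)) has_vector_derivative cis (of_int k * x)) (at x within {-pi..pi})"
      by (simp add: cis_conv_exp mult_ac)
  qed simp
  moreover have "cis (of_int k * pi) = cis (of_int k * (-pi))"
    by (simp add: complex_eq_iff sin_zero_iff_int2)
  ultimately have "integral {-pi..pi} (\<lambda>x. cis (of_int k * x)) = 0"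
    by (simp add: integral_unique)
  then show ?thesis
    using False by (subst lebesgue_integral_eq_integral) auto
qed

lemma L_norm_nonneg: "L_norm g \<ge> 0"
  by (simp add: L_norm_eq)

lemma L_norm_triangle:
  assumes "integrable circ g" "integrable circ h"
  shows "L_norm (\<lambda>x. g x + h x) \<le> L_norm g + L_norm h"
proof -
  have "L_norm (\<lambda>x. g x + h x) \<le> (\<integral>x. cmod (g x) + cmod (h x) \<partial>circ)"
    unfolding L_norm_eq
    by (intro integral_mono) (use assms in \<open>auto intro!: norm_triangle_ineq\<close>)
  also have "\<dots> = L_norm g + L_norm h"
    unfolding L_norm_eq by (intro Bochner_Integration.integral_add) (use assms in auto)
  finally show ?thesis .
qed

lemma L_norm_diff_triangle:
  assumes "integrable circ g" "integrable circ h" "integrable circ k"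
  shows "L_norm (\<lambda>x. g x - k x) \<le> L_norm (\<lambda>x. g x - h x) + L_norm (\<lambda>x. h x - k x)"
  using L_norm_triangle[of "\<lambda>x. g x - h x" "\<lambda>x. h x - k x"] assms by simp

lemma L_norm_sum:
  assumes "\<And>i. i \<in> I \<Longrightarrow> integrable circ (g i)"
  shows "L_norm (\<lambda>x. \<Sum>i\<in>I. g i x) \<le> (\<Sum>i\<in>I. L_norm (g i))"
proof -
  have "L_norm (\<lambda>x. \<Sum>i\<in>I. g i x) \<le> (\<integral>x. (\<Sum>i\<in>I. cmod (g i x)) \<partial>circ)"
    unfolding L_norm_eq by (intro integral_mono) (use assms in \<open>auto intro!: norm_sum\<close>)
  also have "\<dots> = (\<Sum>i\<in>I. L_norm (g i))"
    unfolding L_norm_eq by (intro Bochner_Integration.integral_sum) (use assms in auto)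
  finally show ?thesis .
qed

lemma L_norm_cmult: "L_norm (\<lambda>x. c * g x) = cmod c * L_norm g"
  unfolding L_norm_eq by (simp add: norm_mult)

section \<open>Density of trigonometric polynomials\<close>

text \<open>
  Generated one monomial at a time, because every fact needed about trigonometric polynomials
  (closure under products, being reproduced by late partial sums) then follows by adding a
  single monomial.
\<close>

inductive trig_poly :: "(real \<Rightarrow> complex) \<Rightarrow> bool" where
  zero: "trig_poly (\<lambda>x. 0)"
| step: "trig_poly T \<Longrightarrow> trig_poly (\<lambda>x. T x + c * cis (of_int k * x))"

lemma trig_poly_monomial: "trig_poly (\<lambda>x. c * cis (of_int k * x))"
  using step[OF zero] by simp

lemma trig_poly_const: "trig_poly (\<lambda>x. c)"
  using trig_poly_monomial[of c 0] by simp

lemma trig_poly_add: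
  assumes "trig_poly S" "trig_poly T"
  shows "trig_poly (\<lambda>x. S x + T x)"
  using assms(2)
proof induction
  case zero
  then show ?case using assms(1) by simp
next
  case (step T c k)
  then show ?case using trig_poly.step[OF step.IH, of c k] by (simp add: add.assoc)
qed

lemma trig_poly_mult_monomial:
  assumes "trig_poly T"
  shows "trig_poly (\<lambda>x. T x * (c * cis (of_int k * x)))"
  using assms
proof induction
  case zero
  then show ?case using trig_poly.zero by simp
next
  case (step T b j)
  have "trig_poly (\<lambda>x. T x * (c * cis (of_int k * x)) + (b * c) * cis (of_int (j + k) * x))"
    by (rule trig_poly.step[OF step.IH])
  also have "(\<lambda>x. T x * (c * cis (of_int k * x)) + (b * c) * cis (of_int (j + k) * x))
     = (\<lambda>x. (T x + b * cis (of_int j * x)) * (c * cis (of_int k * x)))"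
    by (simp add: fun_eq_iff algebra_simps cis_mult[symmetric])
  finally show ?case .
qed

lemma trig_poly_mult:
  assumes "trig_poly S" "trig_poly T"
  shows "trig_poly (\<lambda>x. S x * T x)"
  using assms(2)
proof induction
  case zero
  then show ?case using trig_poly.zero by simp
next
  case (step T c k)
  then show ?case
    using trig_poly_add[OF step.IH trig_poly_mult_monomial[OF assms(1), of c k]]
    by (simp add: distrib_left)
qed

lemma trig_poly_integrable: "trig_poly T \<Longrightarrow> integrable circ T"
  by (induction rule: trig_poly.induct) auto

text \<open>
  On the unit circle a polynomial in the real and imaginary parts of the point is a trigonometric
  polynomial, since cosine and sine are combinations of the exponentials of frequency \<open>1\<close> and
  \<open>-1\<close>. This is what makes the Stone-Weierstrass theorem on the circle applicable.
\<close>

lemma trig_poly_real_polynomial: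
  fixes p :: "complex \<Rightarrow> real"
  assumes "real_polynomial_function p"
  shows "trig_poly (\<lambda>x. of_real (p (cis x)))"
  using assms
proof induction
  case (linear h)
  interpret bounded_linear h by fact
  have h: "h z = Re z * h 1 + Im z * h \<i>" for z
  proof -
    have "z = Re z *\<^sub>R 1 + Im z *\<^sub>R \<i>" by (simp add: complex_eq_iff)
    then have "h z = h (Re z *\<^sub>R 1 + Im z *\<^sub>R \<i>)" by simp
    also have "\<dots> = Re z * h 1 + Im z * h \<i>" by (simp only: add scaleR real_scaleR_def)
    finally show ?thesis .
  qed
  have "complex_of_real (h (cis x)) = (of_real (h 1) / 2 + of_real (h \<i>) / (2 * \<i>)) * cis (of_int 1 * x)
      + (of_real (h 1) / 2 - of_real (h \<i>) / (2 * \<i>)) * cis (of_int (-1) * x)" for x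
    by (subst h) (simp add: complex_eq_iff field_simps)
  then show ?case
    by (simp only:) (intro trig_poly_add trig_poly_monomial)
next
  case (const c)
  then show ?case by (rule trig_poly_const)
next
  case (add f g)
  then show ?case by (auto intro!: trig_poly_add)
next
  case (mult f g)
  then show ?case by (auto intro!: trig_poly_mult)
qed

lemma trig_poly_polynomial:
  fixes p :: "complex \<Rightarrow> complex"
  assumes "polynomial_function p"
  shows "trig_poly (\<lambda>x. p (cis x))"
proof -
  have "trig_poly (\<lambda>x. of_real (Re (p (cis x))) + \<i> * of_real (Im (p (cis x))))"
    using assms unfolding polynomial_function_def o_def
    by (intro trig_poly_add trig_poly_mult trig_poly_const trig_poly_real_polynomial[where p="\<lambda>x. Re (p x)"] trig_poly_real_polynomial[where p="\<lambda>x. Im (p x)"])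
      (auto simp: bounded_linear_Re bounded_linear_Im)
  then show ?thesis by (simp add: complex_eq[symmetric])
qed

definition trig_approximable where
  "trig_approximable g \<longleftrightarrow> integrable circ g \<and> (\<forall>e>0. \<exists>T. trig_poly T \<and> L_norm (\<lambda>x. g x - T x) < e)"

lemma trig_approximable_limit:
  assumes f: "integrable circ f" and g: "\<And>n. trig_approximable (g n)"
    and lim: "(\<lambda>n. L_norm (\<lambda>x. f x - g n x)) \<longlonglongrightarrow> 0"
  shows "trig_approximable f"
  unfolding trig_approximable_def
proof (intro conjI allI impI f)
  fix e :: real assume "e > 0"
  then obtain n where n: "L_norm (\<lambda>x. f x - g n x) < e / 2"
    using order_tendstoD(2)[OF lim, of "e/2"] by (auto simp: eventually_sequentially)
  obtain T where T: "trig_poly T" "L_norm (\<lambda>x. g n x - T x) < e / 2"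
    using g[of n] \<open>e > 0\<close> unfolding trig_approximable_def by (meson half_gt_zero)
  have "L_norm (\<lambda>x. f x - T x) < e"
    using L_norm_diff_triangle[of f "g n" T] f g[of n] n T trig_poly_integrable[of T]
    by (auto simp: trig_approximable_def)
  with T show "\<exists>T. trig_poly T \<and> L_norm (\<lambda>x. f x - T x) < e" by blast
qed

lemma L_norm_dominated:
  assumes f: "f \<in> borel_measurable circ" and g: "\<And>n. g n \<in> borel_measurable circ"
    and w: "integrable circ w"
    and lim: "AE x in circ. (\<lambda>n. g n x) \<longlonglongrightarrow> f x"
    and bound: "\<And>n. AE x in circ. cmod (f x - g n x) \<le> w x"
  shows "(\<lambda>n. L_norm (\<lambda>x. f x - g n x)) \<longlonglongrightarrow> 0"
proof -
  have "(\<lambda>n. \<integral>x. cmod (f x - g n x) \<partial>circ) \<longlonglongrightarrow> (\<integral>x. 0 \<partial>circ)"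
  proof (rule integral_dominated_convergence[OF _ _ w])
    show "AE x in circ. (\<lambda>i. cmod (f x - g i x)) \<longlonglongrightarrow> 0"
      using lim by eventually_elim (auto intro!: tendsto_eq_intros)
  qed (use f g bound in auto)
  then show ?thesis by (simp add: L_norm_eq)
qed

text \<open>
  Stone-Weierstrass on the circle gives uniform approximation, which is stronger than
  approximation in norm because the period has finite length.
\<close>

lemma trig_approximable_circle:
  assumes h: "continuous_on (sphere 0 1) h"
  shows "trig_approximable (\<lambda>x. h (cis x))"
  unfolding trig_approximable_def
proof (intro conjI allI impI)
  have cont: "continuous_on UNIV (\<lambda>x. h (cis x))"
    by (rule continuous_on_compose2[OF h]) (auto intro!: continuous_intros)
  have "bounded (h ` sphere 0 1)"
    by (intro compact_imp_bounded compact_continuous_image h) auto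
  then obtain B where "\<forall>z\<in>sphere 0 1. cmod (h z) \<le> B"
    by (auto simp: bounded_iff)
  then have B: "\<And>z. cmod z = 1 \<Longrightarrow> cmod (h z) \<le> B"
    by simp
  show int: "integrable circ (\<lambda>x. h (cis x))"
    by (rule integrable_bounded[where B=B]) (use cont B in auto)
  fix e :: real assume "e > 0"
  define d where "d = e / (4 * pi)"
  have "d > 0" using \<open>e > 0\<close> by (simp add: d_def)
  then obtain p where p: "polynomial_function p" "\<And>z. z \<in> sphere 0 1 \<Longrightarrow> cmod (h z - p z) < d"
    using Stone_Weierstrass_polynomial_function[OF compact_sphere h] by metis
  have T: "trig_poly (\<lambda>x. p (cis x))" by (rule trig_poly_polynomial[OF p(1)])
  have "L_norm (\<lambda>x. h (cis x) - p (cis x)) \<le> (\<integral>x. d \<partial>circ)"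
    unfolding L_norm_eq
    by (intro integral_mono)
       (use int trig_poly_integrable[OF T] p(2) finite_measure.integrable_const[OF circ_finite] in \<open>auto intro: less_imp_le\<close>)
  also have "\<dots> = 2 * pi * d" using measure_circ by simp
  also have "\<dots> < e" using \<open>e > 0\<close> by (simp add: d_def)
  finally show "\<exists>T. trig_poly T \<and> L_norm (\<lambda>x. h (cis x) - T x) < e" using T by blast
qed

lemma AE_circ_interior: "AE x in circ. x \<in> {-pi<..<pi}"
proof -
  have "AE x in lebesgue. x \<notin> {-pi,pi}"
    by (rule AE_not_in) (simp add: negligible_iff_null_sets[symmetric])
  then have "AE x in lebesgue. x \<in> {-pi..pi} \<longrightarrow> x \<in> {-pi<..<pi}"
    by eventually_elim auto
  then show ?thesis
    by (subst AE_restrict_space_iff) auto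
qed

text \<open>
  A continuous function on the line need not have equal values at \<open>-pi\<close> and \<open>pi\<close>, so it is not
  yet a function on the circle. Multiplying it by a factor that vanishes at the point \<open>-1\<close> and
  equals \<open>1\<close> outside a small neighbourhood of it repairs this at a small cost in norm.
\<close>

lemma trig_approximable_continuous:
  fixes g :: "real \<Rightarrow> complex"
  assumes g: "continuous_on UNIV g"
  shows "trig_approximable g"
proof -
  obtain B where "\<forall>x\<in>{-pi..pi}. cmod (g x) \<le> B"
    using compact_imp_bounded[OF compact_continuous_image[OF continuous_on_subset[OF g subset_UNIV], of "{-pi..pi}"]]
    by (auto simp: bounded_iff)
  then have B: "\<And>x. x \<in> {-pi..pi} \<Longrightarrow> cmod (g x) \<le> B" by blast
  define B' where "B' = max B 0"
  have B': "x \<in> {-pi..pi} \<Longrightarrow> cmod (g x) \<le> B'" "B' \<ge> 0" for x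
    using B[of x] by (auto simp: B'_def)
  have gm: "g \<in> borel_measurable circ" using g by (rule measurable_continuous_circ)
  have gi: "integrable circ g"
    by (rule finite_measure.integrable_const_bound[OF circ_finite, where B=B'])
       (use B' gm in auto)
  \<comment> \<open>The cut-off vanishes at z = -1, the only unit point where Arg jumps, so h n is continuous.\<close>
  define h where "h n z = g (Arg z) * of_real (min 1 (real n * cmod (z + 1)))" for n z
  have hc: "continuous_on (sphere 0 1) (h n)" for n
    unfolding continuous_on_eq_continuous_within
  proof
    fix z :: complex assume z: "z \<in> sphere 0 1"
    show "continuous (at z within sphere 0 1) (h n)"
    proof (cases "z = -1")
      case False
      have "z \<notin> \<real>\<^sub>\<le>\<^sub>0"
      proof
        assume "z \<in> \<real>\<^sub>\<le>\<^sub>0"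
        then obtain r where "z = of_real r" "r \<le> 0" by (auto simp: nonpos_Reals_def)
        with z False show False by auto
      qed
      then have "isCont (\<lambda>z. g (Arg z)) z"
        using g continuous_at_Arg[of z] by (intro continuous_at_compose[of z Arg g, unfolded o_def])
           (auto simp: continuous_on_eq_continuous_at)
      then have "isCont (h n) z"
        unfolding h_def by (intro continuous_intros)
      then show ?thesis by (rule continuous_at_imp_continuous_at_within)
    next
      case True
      have "((\<lambda>w. B' * (real n * cmod (w + 1))) \<longlongrightarrow> B' * (real n * cmod (z + 1))) (at z within sphere 0 1)"
        by (intro tendsto_intros)
      then have lim: "((\<lambda>w. B' * (real n * cmod (w + 1))) \<longlongrightarrow> 0) (at z within sphere 0 1)"
        using True by simp
      have "(h n \<longlongrightarrow> 0) (at z within sphere 0 1)"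
      proof (rule Lim_null_comparison[OF _ lim], rule always_eventually, rule allI)
        fix w
        have "cmod (g (Arg w)) \<le> B'" using Arg_bounded[of w] by (intro B') auto
        then show "cmod (h n w) \<le> B' * (real n * cmod (w + 1))"
          unfolding h_def norm_mult norm_of_real using B'(2)
          by (intro mult_mono) auto
      qed
      then show ?thesis using True by (simp add: continuous_within h_def)
    qed
  qed
  have hcis: "h n (cis x) = g x * of_real (min 1 (real n * cmod (cis x + 1)))" if "x \<in> {-pi..pi}" for n x
  proof (cases "x = -pi")
    case True
    moreover have "cis (-pi) = -1" by (simp add: complex_eq_iff)
    ultimately show ?thesis by (simp add: h_def)
  next
    case False
    then have "Arg (cis x) = x" using that by (intro Arg_cis) auto
    then show ?thesis by (simp add: h_def)
  qed
  have happ: "trig_approximable (\<lambda>x. h n (cis x))" for n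
    by (rule trig_approximable_circle[OF hc])
  show ?thesis
  proof (rule trig_approximable_limit[OF gi happ], rule L_norm_dominated[OF gm, where w="\<lambda>x. B'"])
    show "(\<lambda>x. h n (cis x)) \<in> borel_measurable circ" for n
      using happ[of n] by (auto simp: trig_approximable_def)
    show "integrable circ (\<lambda>x. B')" using finite_measure.integrable_const[OF circ_finite] by simp
    show "AE x in circ. (\<lambda>n. h n (cis x)) \<longlonglongrightarrow> g x"
      using AE_circ_interior
    proof eventually_elim
      case (elim x)
      have "cmod (cis x + 1) > 0"
      proof -
        have "cis x \<noteq> -1"
        proof
          assume "cis x = -1"
          then have "Arg (cis x) = Arg (cis pi)" by simp
          then have "Arg (cis x) = pi" by (simp add: Arg_cis del: cis_pi)
          moreover have "Arg (cis x) = x" using elim by (intro Arg_cis) auto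
          ultimately show False using elim by auto
        qed
        then have "cis x + 1 \<noteq> 0" by (simp add: add_eq_0_iff2)
        then show ?thesis by simp
      qed
      then have "\<forall>\<^sub>F n in sequentially. 1 \<le> real n * cmod (cis x + 1)"
        using filterlim_real_sequentially
        by (intro filterlim_at_top[THEN iffD1, rule_format, of _ _ 1] filterlim_at_top_mult_tendsto_pos[of _ "cmod (cis x + 1)"] ) auto
      then have "\<forall>\<^sub>F n in sequentially. h n (cis x) = g x"
        by eventually_elim (use hcis elim in \<open>auto simp: min_def\<close>)
      then show ?case by (rule tendsto_eventually)
    qed
    show "AE x in circ. cmod (g x - h n (cis x)) \<le> B'" for n
    proof (rule AE_I2)
      fix x assume "x \<in> space circ"
      then have x: "x \<in> {-pi..pi}" by simp
      define m where "m = min 1 (real n * cmod (cis x + 1))"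
      have m: "0 \<le> m" "m \<le> 1" by (auto simp: m_def)
      have "g x - h n (cis x) = g x * of_real (1 - m)"
        using hcis[OF x] by (simp add: m_def algebra_simps)
      also have "cmod \<dots> \<le> B' * 1"
        unfolding norm_mult norm_of_real using m x B' by (intro mult_mono) auto
      finally show "cmod (g x - h n (cis x)) \<le> B'" by simp
    qed
  qed
qed

text \<open>
  A measurable function is an almost everywhere limit of continuous ones. Projecting these onto the
  disc that contains the values of \<open>f\<close> keeps them continuous and makes dominated convergence
  applicable.
\<close>

lemma trig_approximable_bounded:
  fixes f :: "real \<Rightarrow> complex"
  assumes f: "f \<in> borel_measurable circ" and B: "\<And>x. cmod (f x) \<le> B"
  shows "trig_approximable f"
proof -
  have "f measurable_on {-pi..pi}"
    using f by (simp add: measurable_on_iff_borel_measurable)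
  then obtain N g where N: "negligible N" and gc: "\<And>n. continuous_on UNIV (g n)"
    and lim: "\<And>x. x \<notin> N \<Longrightarrow> (\<lambda>n. g n x) \<longlonglongrightarrow> (if x \<in> {-pi..pi} then f x else 0)"
    unfolding measurable_on_def by metis
  have "B \<ge> 0" using B[of 0] norm_ge_zero order_trans by blast
  define clip where "clip = closest_point (cball (0::complex) B)"
  have ne: "cball (0::complex) B \<noteq> {}" using \<open>B \<ge> 0\<close> by auto
  have clip_c: "continuous_on UNIV clip"
    unfolding clip_def by (intro continuous_on_closest_point) (use ne in auto)
  have clip_b: "cmod (clip z) \<le> B" for z
    using closest_point_in_set[OF closed_cball ne, of z] by (simp add: clip_def)
  have clip_id: "clip z = z" if "cmod z \<le> B" for z
    using that unfolding clip_def by (intro closest_point_self) auto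
  have gc': "continuous_on UNIV (\<lambda>x. clip (g n x))" for n
    by (rule continuous_on_compose2[OF clip_c gc]) auto
  show ?thesis
  proof (rule trig_approximable_limit, rule integrable_bounded[OF f B], rule trig_approximable_continuous[OF gc'],
      rule L_norm_dominated[OF f, where w="\<lambda>x. 2 * B"])
    show "(\<lambda>x. clip (g n x)) \<in> borel_measurable circ" for n
      by (rule measurable_continuous_circ[OF gc'])
    show "integrable circ (\<lambda>x. 2 * B)" using finite_measure.integrable_const[OF circ_finite] by simp
    have "AE x in lebesgue. x \<notin> N"
      by (rule AE_not_in) (use N in \<open>simp add: negligible_iff_null_sets\<close>)
    then have "AE x in lebesgue. x \<in> {-pi..pi} \<longrightarrow> (\<lambda>n. clip (g n x)) \<longlonglongrightarrow> f x"
    proof eventually_elim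
      case (elim x)
      have "(\<lambda>n. clip (g n x)) \<longlonglongrightarrow> clip (f x)" if "x \<in> {-pi..pi}"
        by (rule continuous_on_tendsto_compose[OF clip_c]) (use lim[OF elim] that in auto)
      then show ?case using clip_id[OF B] by simp
    qed
    then show "AE x in circ. (\<lambda>n. clip (g n x)) \<longlonglongrightarrow> f x"
      by (subst AE_restrict_space_iff) auto
    show "AE x in circ. cmod (f x - clip (g n x)) \<le> 2 * B" for n
      using norm_triangle_ineq4[of "f x" "clip (g n x)" for x] B clip_b
      by (intro AE_I2) (smt (verit))
  qed
qed

text \<open>
  Truncating at height \<open>n\<close> reduces the density of trigonometric polynomials to bounded functions.
\<close>

lemma trig_approximable_integrable:
  fixes f :: "real \<Rightarrow> complex"
  assumes f: "integrable circ f"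
  shows "trig_approximable f"
proof -
  define g where "g n x = (if cmod (f x) \<le> real n then f x else 0)" for n x
  have fm: "f \<in> borel_measurable circ" using f by auto
  have gm: "g n \<in> borel_measurable circ" for n
    unfolding g_def using fm by measurable
  have gb: "cmod (g n x) \<le> real n" for n x by (auto simp: g_def)
  show ?thesis
  proof (rule trig_approximable_limit[OF f], rule trig_approximable_bounded[OF gm gb],
      rule L_norm_dominated[OF fm gm, where w="\<lambda>x. cmod (f x)"])
    show "AE x in circ. (\<lambda>n. g n x) \<longlonglongrightarrow> f x"
    proof (rule AE_I2)
      fix x
      obtain N where "cmod (f x) \<le> real N" using real_arch_simple by blast
      then have "\<forall>\<^sub>F n in sequentially. g n x = f x"
        by (auto simp: g_def eventually_sequentially intro!: exI[of _ N])
      then show "(\<lambda>n. g n x) \<longlonglongrightarrow> f x" by (rule tendsto_eventually)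
    qed
  qed (use f in \<open>auto simp: g_def\<close>)
qed

section \<open>Fourier coefficients and partial sums\<close>

lemma fourier_coeff_add:
  assumes "integrable circ g" "integrable circ h"
  shows "fourier_coeff (\<lambda>x. g x + h x) k = fourier_coeff g k + fourier_coeff h k"
  using assms by (simp add: fourier_coeff_eq distrib_right add_divide_distrib)

lemma fourier_coeff_diff:
  assumes "integrable circ g" "integrable circ h"
  shows "fourier_coeff (\<lambda>x. g x - h x) k = fourier_coeff g k - fourier_coeff h k"
  using assms by (simp add: fourier_coeff_eq left_diff_distrib diff_divide_distrib)

lemma fourier_coeff_cmult: "fourier_coeff (\<lambda>x. c * g x) k = c * fourier_coeff g k"
  by (simp add: fourier_coeff_eq mult.assoc)

lemma fourier_coeff_sum:
  assumes "\<And>i. i \<in> I \<Longrightarrow> integrable circ (g i)"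
  shows "fourier_coeff (\<lambda>x. \<Sum>i\<in>I. g i x) k = (\<Sum>i\<in>I. fourier_coeff (g i) k)"
  using assms by (simp add: fourier_coeff_eq sum_distrib_right sum_divide_distrib Bochner_Integration.integral_sum)

lemma fourier_coeff_cis: "fourier_coeff (\<lambda>x. cis (of_int j * x)) k = (if k = j then 1 else 0)"
proof -
  have "(\<integral>x. cis (of_int j * x) * cis (- (of_int k * x)) \<partial>circ) = (\<integral>x. cis (of_int (j - k) * x) \<partial>circ)"
    by (simp add: cis_mult algebra_simps)
  then show ?thesis by (simp only: fourier_coeff_eq integral_cis) auto
qed

lemma fourier_partial_sum_diff:
  assumes "integrable circ g" "integrable circ h"
  shows "fourier_partial_sum n (\<lambda>x. g x - h x) x = fourier_partial_sum n g x - fourier_partial_sum n h x"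
  using assms by (simp add: fourier_partial_sum_eq fourier_coeff_diff left_diff_distrib sum_subtractf)

lemma integrable_fourier_partial_sum [simp]: "integrable circ (fourier_partial_sum n g)"
  unfolding fourier_partial_sum_eq[abs_def] by auto

lemma fourier_coeff_partial_sum:
  "fourier_coeff (fourier_partial_sum n g) k = (if k \<in> {-int n..int n} then fourier_coeff g k else 0)"
  unfolding fourier_partial_sum_eq[abs_def]
  by (subst fourier_coeff_sum) (auto simp: fourier_coeff_cmult fourier_coeff_cis if_distrib cong: if_cong)

lemma trig_poly_reproduced:
  assumes "trig_poly T"
  shows "\<exists>N. \<forall>n\<ge>N. fourier_partial_sum n T = T"
  using assms
proof induction
  case zero
  then show ?case by (auto simp: fun_eq_iff fourier_partial_sum_eq fourier_coeff_eq)
next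
  case (step T c k)
  then obtain N where N: "\<And>n. n \<ge> N \<Longrightarrow> fourier_partial_sum n T = T" by blast
  have "fourier_partial_sum n (\<lambda>x. T x + c * cis (of_int k * x)) = (\<lambda>x. T x + c * cis (of_int k * x))"
    if n: "n \<ge> max N (nat \<bar>k\<bar>)" for n
  proof
    fix x
    have k: "k \<in> {-int n..int n}" using n by auto
    have "fourier_partial_sum n (\<lambda>x. T x + c * cis (of_int k * x)) x =
        fourier_partial_sum n T x + (\<Sum>j\<in>{-int n..int n}. if j = k then c * cis (of_int j * x) else 0)"
      unfolding fourier_partial_sum_eq sum.distrib[symmetric]
      using trig_poly_integrable[OF step.hyps]
      by (intro sum.cong) (auto simp: fourier_coeff_add fourier_coeff_cmult fourier_coeff_cis distrib_right)
    also have "\<dots> = T x + c * cis (of_int k * x)"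
      using N[of n] n k by simp
    finally show "fourier_partial_sum n (\<lambda>x. T x + c * cis (of_int k * x)) x = T x + c * cis (of_int k * x)" .
  qed
  then show ?case by blast
qed

section \<open>Averages of partial sums\<close>

text \<open>
  Summing the symmetric ranges \<open>[-m, m]\<close> for \<open>m < N\<close> hits each integer as often as it is a
  difference of two numbers below \<open>N\<close>. With exponentials in place of \<open>c\<close> this writes the sum of
  the first \<open>N\<close> Dirichlet kernels as a square, the Fejer kernel.
\<close>

lemma sum_symmetric_ranges:
  fixes c :: "int \<Rightarrow> 'a::comm_monoid_add"
  shows "(\<Sum>m<N. \<Sum>k\<in>{-int m..int m}. c k) = (\<Sum>k<N. \<Sum>l<N. c (int k - int l))"
proof (induction N)
  case (Suc N)
  have "{-int N..int N} = (\<lambda>k. int k - int N) ` {..<N} \<union> (\<lambda>l. int N - int l) ` {..<N} \<union> {0}"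
  proof (intro equalityI subsetI)
    fix z assume z: "z \<in> {-int N..int N}"
    consider "z = 0" | "z < 0" | "z > 0" by linarith
    then show "z \<in> (\<lambda>k. int k - int N) ` {..<N} \<union> (\<lambda>l. int N - int l) ` {..<N} \<union> {0}"
    proof cases
      case 2
      then have "z = int (nat (z + int N)) - int N" "nat (z + int N) < N" using z by auto
      then show ?thesis by blast
    next
      case 3
      then have "z = int N - int (nat (int N - z))" "nat (int N - z) < N" using z by auto
      then show ?thesis by blast
    qed auto
  qed auto
  moreover have "(\<Sum>k\<in>(\<lambda>k. int k - int N) ` {..<N} \<union> (\<lambda>l. int N - int l) ` {..<N} \<union> {0}. c k)
     = (\<Sum>k<N. c (int k - int N)) + (\<Sum>l<N. c (int N - int l)) + c 0"
    by (subst sum.union_disjoint, simp, simp, force, subst sum.union_disjoint, simp, simp, force)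
       (auto simp: sum.reindex inj_on_def)
  ultimately have *: "(\<Sum>k\<in>{-int N..int N}. c k) = (\<Sum>k<N. c (int k - int N)) + (\<Sum>l<N. c (int N - int l)) + c 0"
    by simp
  show ?case
    unfolding lessThan_Suc sum.insert[OF finite_lessThan] 
    by (simp add: sum.distrib Suc.IH * add_ac)
qed simp

lemma fejer_kernel_expand:
  "complex_of_real ((cmod (\<Sum>k<N. cis (real k * (x - t))))\<^sup>2)
      = (\<Sum>k<N. \<Sum>l<N. cis (- (of_int (int k - int l) * t)) * cis (of_int (int k - int l) * x))"
  unfolding complex_norm_square cnj_sum sum_product
  by (simp add: cis_cnj cis_mult algebra_simps)

text \<open>
  Only the diagonal terms of the expanded square survive integration. As the kernel is
  nonnegative, this is also its norm, uniformly in the translation \<open>t\<close>.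
\<close>

lemma fejer_kernel_integral:
  "(\<integral>x. (cmod (\<Sum>k<N. cis (real k * (x - t))))\<^sup>2 \<partial>circ) = 2 * pi * real N"
proof -
  have "complex_of_real (\<integral>x. (cmod (\<Sum>k<N. cis (real k * (x - t))))\<^sup>2 \<partial>circ)
     = (\<integral>x. complex_of_real ((cmod (\<Sum>k<N. cis (real k * (x - t))))\<^sup>2) \<partial>circ)"
    by (rule integral_complex_of_real[symmetric])
  also have "\<dots> = (\<Sum>k<N. \<Sum>l<N. cis (- (of_int (int k - int l) * t)) * (\<integral>x. cis (of_int (int k - int l) * x) \<partial>circ))"
    unfolding fejer_kernel_expand by (simp add: Bochner_Integration.integral_sum del: of_int_diff)
  also have "\<dots> = (\<Sum>k<N. \<Sum>l<N. if l = k then 2 * of_real pi else 0)"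
    unfolding integral_cis by (intro sum.cong) auto
  also have "\<dots> = complex_of_real (2 * pi * real N)" by simp
  finally show ?thesis by (simp only: of_real_eq_iff)
qed

text \<open>
  By duality: the norm of the sum \<open>A\<close> is its integral against the bounded function
  \<open>h = cnj (sgn A)\<close>. Moving the kernel from \<open>g\<close> to \<open>h\<close> only exchanges finite sums with
  integrals, and the kernel applied to \<open>h\<close> is bounded pointwise by the integral of the Fejer
  kernel.
\<close>

lemma fejer_L1_bound:
  assumes g: "integrable circ g"
  shows "L_norm (\<lambda>x. \<Sum>m<N. fourier_partial_sum m g x) \<le> real N * L_norm g"
proof -
  define A where "A x = (\<Sum>m<N. fourier_partial_sum m g x)" for x
  define h where "h x = cnj (sgn (A x))" for x
  define \<Phi> where "\<Phi> t = (\<integral>x. of_real ((cmod (\<Sum>k<N. cis (real k * (x - t))))\<^sup>2) * h x \<partial>circ)" for t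
  have A_eq: "A x = (\<Sum>k<N. \<Sum>l<N. fourier_coeff g (int k - int l) * cis (of_int (int k - int l) * x))" for x
    unfolding A_def fourier_partial_sum_eq by (rule sum_symmetric_ranges)
  have Aint: "integrable circ A" unfolding A_def[abs_def] by auto
  then have Am: "A \<in> borel_measurable circ" by auto
  have hm: "h \<in> borel_measurable circ"
  proof -
    have "(\<lambda>x. cnj (A x)) \<in> borel_measurable circ"
      by (rule measurable_compose[OF Am borel_measurable_continuous_onI]) (intro continuous_intros)
    with Am show ?thesis by (simp add: h_def[abs_def] sgn_eq)
  qed
  have hb: "cmod (h x) \<le> 1" for x by (simp add: h_def norm_sgn)
  have Ah: "A x * h x = of_real (cmod (A x))" for x
    by (cases "A x = 0") (simp_all add: h_def sgn_eq complex_norm_square[symmetric] power2_eq_square)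
  have ih: "integrable circ (\<lambda>x. cis (c * x) * h x)" for c
    by (rule integrable_bounded_mult[OF _ hm hb]) simp
  have \<Phi>_eq: "\<Phi> t = (\<Sum>k<N. \<Sum>l<N. cis (- (of_int (int k - int l) * t)) * (\<integral>x. cis (of_int (int k - int l) * x) * h x \<partial>circ))" for t
    unfolding \<Phi>_def fejer_kernel_expand sum_distrib_right mult.assoc
    using ih by (simp add: Bochner_Integration.integral_sum del: of_int_diff)
  have kint: "integrable circ (\<lambda>x. (cmod (\<Sum>k<N. cis (real k * (x - t))))\<^sup>2)" for t
  proof (rule integrable_bounded[where B="real N ^ 2"])
    show "norm ((cmod (\<Sum>k<N. cis (real k * (x - t))))\<^sup>2) \<le> (real N)\<^sup>2" for x
      using norm_sum[of "\<lambda>k. cis (real k * (x - t))" "{..<N}"] by (auto intro: power_mono)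
    show "(\<lambda>x. (cmod (\<Sum>k<N. cis (real k * (x - t))))\<^sup>2) \<in> borel_measurable circ"
      by (intro measurable_continuous_circ continuous_intros)
  qed
  have \<Phi>_bound: "cmod (\<Phi> t) \<le> 2 * pi * real N" for t
  proof -
    have "cmod (\<Phi> t) \<le> (\<integral>x. (cmod (\<Sum>k<N. cis (real k * (x - t))))\<^sup>2 \<partial>circ)"
      unfolding \<Phi>_def
    proof (rule Bochner_Integration.integral_norm_bound_integral)
      show "integrable circ (\<lambda>x. complex_of_real ((cmod (\<Sum>k<N. cis (real k * (x - t))))\<^sup>2) * h x)"
        by (rule integrable_bounded_mult[OF _ hm hb]) (rule integrable_of_real[OF kint])
      show "cmod (complex_of_real ((cmod (\<Sum>k<N. cis (real k * (x - t))))\<^sup>2) * h x) \<le> (cmod (\<Sum>k<N. cis (real k * (x - t))))\<^sup>2" for x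
        unfolding norm_mult norm_of_real using hb[of x] by (simp add: mult_left_le)
    qed (rule kint)
    then show ?thesis by (simp add: fejer_kernel_integral)
  qed
  have \<Phi>m: "\<Phi> \<in> borel_measurable circ"
    unfolding \<Phi>_eq[abs_def] by (intro measurable_continuous_circ continuous_intros)
  have "complex_of_real (L_norm A) = (\<integral>x. A x * h x \<partial>circ)"
    unfolding L_norm_eq Ah by simp
  also have "\<dots> = (\<Sum>k<N. \<Sum>l<N. fourier_coeff g (int k - int l) * (\<integral>x. cis (of_int (int k - int l) * x) * h x \<partial>circ))"
    unfolding A_eq sum_distrib_right mult.assoc
    using ih by (simp add: Bochner_Integration.integral_sum del: of_int_diff)
  also have "\<dots> = (\<integral>t. g t * \<Phi> t \<partial>circ) / (2 * of_real pi)"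
    unfolding \<Phi>_eq sum_distrib_left mult.assoc[symmetric] fourier_coeff_eq
    using g by (simp add: Bochner_Integration.integral_sum sum_divide_distrib del: of_int_diff)
  finally have eq: "complex_of_real (L_norm A) = (\<integral>t. g t * \<Phi> t \<partial>circ) / (2 * of_real pi)" .
  have "cmod (\<integral>t. g t * \<Phi> t \<partial>circ) \<le> (\<integral>t. 2 * pi * real N * cmod (g t) \<partial>circ)"
  proof (rule Bochner_Integration.integral_norm_bound_integral)
    show "integrable circ (\<lambda>t. g t * \<Phi> t)" by (rule integrable_bounded_mult[OF g \<Phi>m \<Phi>_bound])
    show "integrable circ (\<lambda>t. 2 * pi * real N * cmod (g t))" using g by auto
    show "cmod (g t * \<Phi> t) \<le> 2 * pi * real N * cmod (g t)" for t
      using mult_right_mono[OF \<Phi>_bound[of t], of "cmod (g t)"] by (simp add: norm_mult mult.commute)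
  qed
  also have "\<dots> = 2 * pi * (real N * L_norm g)" by (simp add: L_norm_eq)
  finally have "cmod (complex_of_real (L_norm A)) \<le> real N * L_norm g"
    unfolding eq by (simp add: norm_divide field_simps)
  then show ?thesis by (simp add: A_def[abs_def])
qed

text \<open>
  The average of \<open>f - S m\<close> over \<open>n \<le> m < M\<close> tends to zero in norm when \<open>M + n\<close> is at most a fixed
  multiple of \<open>M - n\<close>. A trigonometric polynomial \<open>T\<close> close to \<open>f\<close> is reproduced by all \<open>S m\<close> with
  \<open>m \<ge> n\<close>, so only the small remainder \<open>f - T\<close> matters, and on it the averages act as a difference
  of two Fejer sums, of norms at most \<open>M\<close> and \<open>n\<close>.
\<close>

lemma vallee_poussin_means:
  assumes f: "integrable circ f" and "\<delta> > 0"
  shows "\<exists>n0. \<forall>n\<ge>n0. \<forall>M>n. real (M + n) \<le> K * real (M - n) \<longrightarrow>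
    L_norm (\<lambda>x. \<Sum>m=n..<M. f x - fourier_partial_sum m f x) \<le> \<delta> * real (M - n)"
proof -
  \<comment> \<open>The factor 1 pays for f - T itself, the factor K for the two Fejer sums.\<close>
  define e where "e = \<delta> / (1 + \<bar>K\<bar>)"
  have e: "e > 0" using \<open>\<delta> > 0\<close> by (simp add: e_def add_pos_nonneg)
  obtain T where T: "trig_poly T" and fT: "L_norm (\<lambda>x. f x - T x) < e"
    using trig_approximable_integrable[OF f] e unfolding trig_approximable_def by blast
  have Ti: "integrable circ T" by (rule trig_poly_integrable[OF T])
  obtain N where N: "\<And>n. n \<ge> N \<Longrightarrow> fourier_partial_sum n T = T"
    using trig_poly_reproduced[OF T] by blast
  show ?thesis
  proof (intro exI[of _ N] allI impI)
    fix n M assume n: "n \<ge> N" and M: "M > n" and K: "real (M + n) \<le> K * real (M - n)"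
    define g where "g x = f x - T x" for x
    have gi: "integrable circ g" using f Ti by (simp add: g_def[abs_def])
    define A where "A M x = (\<Sum>m<M. fourier_partial_sum m g x)" for M x
    have Ai: "integrable circ (A M)" for M by (auto simp: A_def[abs_def])
    have "(\<Sum>m=n..<M. f x - fourier_partial_sum m f x) = of_nat (M - n) * g x + (A n x - A M x)" for x
    proof -
      have "(\<Sum>m=n..<M. f x - fourier_partial_sum m f x) = (\<Sum>m=n..<M. g x - fourier_partial_sum m g x)"
        using n N f Ti by (intro sum.cong) (auto simp: g_def[abs_def] fourier_partial_sum_diff)
      also have "\<dots> = of_nat (M - n) * g x - (\<Sum>m=n..<M. fourier_partial_sum m g x)"
        by (simp add: sum_subtractf)
      also have "(\<Sum>m=n..<M. fourier_partial_sum m g x) = A M x - A n x"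
        using M unfolding A_def by (subst sum_diff_nat_ivl[of 0 n M, simplified, symmetric]) (auto simp: atLeast0LessThan)
      finally show ?thesis by (simp add: algebra_simps)
    qed
    then have "L_norm (\<lambda>x. \<Sum>m=n..<M. f x - fourier_partial_sum m f x)
       = L_norm (\<lambda>x. of_nat (M - n) * g x + (A n x - A M x))" by simp
    also have "\<dots> \<le> L_norm (\<lambda>x. of_nat (M - n) * g x) + L_norm (\<lambda>x. A n x + - 1 * A M x)"
      using L_norm_triangle[of "\<lambda>x. of_nat (M - n) * g x" "\<lambda>x. A n x - A M x"] gi Ai by simp
    also have "L_norm (\<lambda>x. of_nat (M - n) * g x) = real (M - n) * L_norm g"
      by (simp add: L_norm_cmult del: of_nat_diff)
    also have "L_norm (\<lambda>x. A n x + - 1 * A M x) \<le> L_norm (A n) + L_norm (\<lambda>x. - 1 * A M x)"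
      by (intro L_norm_triangle) (use Ai in auto)
    also have "\<dots> = L_norm (A n) + L_norm (A M)" by (simp only: L_norm_cmult) simp
    also have "\<dots> \<le> real n * L_norm g + real M * L_norm g"
      unfolding A_def by (intro add_mono fejer_L1_bound gi)
    finally have "L_norm (\<lambda>x. \<Sum>m=n..<M. f x - fourier_partial_sum m f x)
        \<le> (real (M - n) + real (M + n)) * L_norm g" by (simp add: algebra_simps)
    also have "\<dots> \<le> (real (M - n) + \<bar>K\<bar> * real (M - n)) * e"
    proof (intro mult_mono add_left_mono)
      have "K * real (M - n) \<le> \<bar>K\<bar> * real (M - n)" by (intro mult_right_mono) auto
      then show "real (M + n) \<le> \<bar>K\<bar> * real (M - n)" using K by linarith
      show "L_norm g \<le> e" using fT by (simp add: g_def[abs_def])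
    qed (auto simp: L_norm_nonneg)
    also have "\<dots> = real (M - n) * ((1 + \<bar>K\<bar>) * e)" by (simp add: algebra_simps)
    also have "(1 + \<bar>K\<bar>) * e = \<delta>" by (simp add: e_def add_pos_nonneg[THEN less_imp_neq, symmetric] )
    finally show "L_norm (\<lambda>x. \<Sum>m=n..<M. f x - fourier_partial_sum m f x) \<le> \<delta> * real (M - n)"
      by (simp add: mult.commute)
  qed
qed

section \<open>Two estimates for exponential sums\<close>

lemma jordan_sin:
  assumes "0 \<le> t" "t \<le> 1"
  shows "t \<le> sin (t * (pi / 2))"
proof -
  have "convex_on {0..pi/2} (\<lambda>x. - sin x)"
  proof (rule f''_ge0_imp_convex)
    show "((\<lambda>x. - sin x) has_real_derivative - cos x) (at x)" for x :: real
      by (auto intro!: derivative_eq_intros)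
    show "((\<lambda>x. - cos x) has_real_derivative sin x) (at x)" for x :: real
      by (auto intro!: derivative_eq_intros)
    show "0 \<le> sin x" if "x \<in> {0..pi/2}" for x :: real
      using that by (intro sin_ge_zero) auto
  qed auto
  from convex_onD[OF this, of t 0 "pi/2"] show ?thesis using assms by simp
qed

lemma sin_half_lower: 
  assumes "\<bar>x\<bar> \<le> pi"
  shows "\<bar>x\<bar> \<le> pi * \<bar>sin (x / 2)\<bar>"
proof -
  have "\<bar>x\<bar> / pi \<le> sin (\<bar>x\<bar> / pi * (pi / 2))"
    by (rule jordan_sin) (use assms in auto)
  also have "\<bar>x\<bar> / pi * (pi / 2) = \<bar>x\<bar> / 2" by simp
  also have "sin (\<bar>x\<bar> / 2) \<le> \<bar>sin (x / 2)\<bar>" by (cases "x \<ge> 0") auto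
  finally show ?thesis by (simp add: field_simps)
qed

text \<open>
  The closed form of the geometric sum has numerator at most \<open>2\<close>, and
  \<open>|1 - cis x| = 2 |sin (x / 2)|\<close>. Stated as a product so that the zeros of the sine need no
  separate treatment.
\<close>

lemma geometric_cis_bound: "\<bar>sin (x / 2)\<bar> * cmod (\<Sum>j=p..q. cis (real j * x)) \<le> 1"
proof (cases "p \<le> q")
  case True
  have pw: "cis (real j * x) = cis x ^ j" for j by (rule Complex.DeMoivre[symmetric])
  have "(1 - cis x) * (\<Sum>j=p..q. cis (real j * x)) = cis (real p * x) - cis (real (Suc q) * x)"
    using sum_gp_multiplied[OF True, of "cis x"] by (simp only: pw)
  then have "cmod (1 - cis x) * cmod (\<Sum>j=p..q. cis (real j * x)) = cmod (cis (real p * x) - cis (real (Suc q) * x))"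
    by (metis norm_mult)
  also have "\<dots> \<le> cmod (cis (real p * x)) + cmod (cis (real (Suc q) * x))" by (rule norm_triangle_ineq4)
  also have "\<dots> = 2" by simp
  finally have *: "cmod (1 - cis x) * cmod (\<Sum>j=p..q. cis (real j * x)) \<le> 2" .
  have "1 - cis x = - 2 * \<i> * of_real (sin (x / 2)) * cis (x / 2)"
    using sin_double[of "x/2"] cos_double_sin[of "x/2"]
    by (simp add: complex_eq_iff power2_eq_square)
  then have "cmod (1 - cis x) = 2 * \<bar>sin (x / 2)\<bar>" by (simp only:) (simp add: norm_mult)
  with * show ?thesis by simp
qed simp

lemma sum_by_parts:
  fixes u e :: "nat \<Rightarrow> 'a::comm_ring"
  assumes "p \<le> q"
  shows "(\<Sum>k=p..q. u k * e k) = u q * (\<Sum>j=p..q. e j) - (\<Sum>k=p..<q. (u (Suc k) - u k) * (\<Sum>j=p..k. e j))"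
  using assms
proof (induction q rule: dec_induct)
  case (step q)
  then show ?case by (simp add: algebra_simps)
qed simp

lemma abs_sin_mult_le: "\<bar>sin (real j * x)\<bar> \<le> real j * \<bar>sin x\<bar>"
proof (induction j)
  case (Suc j)
  have "sin (real (Suc j) * x) = sin (real j * x) * cos x + cos (real j * x) * sin x"
    by (simp add: distrib_right sin_add add.commute)
  also have "\<bar>\<dots>\<bar> \<le> \<bar>sin (real j * x)\<bar> * \<bar>cos x\<bar> + \<bar>cos (real j * x)\<bar> * \<bar>sin x\<bar>"
    by (metis abs_mult abs_triangle_ineq)
  also have "\<dots> \<le> \<bar>sin (real j * x)\<bar> * 1 + 1 * \<bar>sin x\<bar>"
    by (intro add_mono mult_mono) auto
  finally show ?case using Suc.IH by (simp add: distrib_right)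
qed simp

text \<open>
  With \<open>s = |sin (x / 2)|\<close>: the terms with \<open>j \<le> 1 / s\<close> are at most \<open>2 s\<close> each and contribute at most
  \<open>2\<close>; beyond, the sums of \<open>sin (j x)\<close> are bounded by \<open>1 / s\<close>, and summation by parts against the
  decreasing \<open>1 / j \<le> s\<close> contributes at most \<open>1\<close>.
\<close>

lemma sin_series_bounded: "\<bar>\<Sum>j=1..J. sin (real j * x) / real j\<bar> \<le> 3"
proof -
  define s where "s = \<bar>sin (x / 2)\<bar>"
  have s0: "s \<ge> 0" by (simp add: s_def)
  have "\<bar>sin x\<bar> \<le> 2 * s"
    using abs_sin_mult_le[of 2 "x/2"] by (simp add: s_def)
  have head: "\<bar>\<Sum>j=1..N. sin (real j * x) / real j\<bar> \<le> 2 * (real N * s)" for N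
  proof -
    have "\<bar>\<Sum>j=1..N. sin (real j * x) / real j\<bar> \<le> (\<Sum>j=1..N. 2 * s)"
    proof (rule order_trans[OF sum_abs], rule sum_mono)
      fix j assume j: "j \<in> {1..N}"
      have "\<bar>sin (real j * x)\<bar> \<le> real j * (2 * s)"
        using abs_sin_mult_le[of j x] mult_left_mono[OF \<open>\<bar>sin x\<bar> \<le> 2 * s\<close>, of "real j"] by linarith
      then show "\<bar>sin (real j * x) / real j\<bar> \<le> 2 * s"
        using j by (simp add: field_simps)
    qed
    then show ?thesis by (simp add: mult_ac)
  qed
  show ?thesis
  proof (cases "real J * s \<le> 1")
    case True
    then show ?thesis using head[of J] by linarith
  next
    case False
    then have s: "s > 0" using s0 by (cases "s = 0") auto
    define N where "N = nat \<lfloor>1 / s\<rfloor>"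
    have N: "real N = of_int \<lfloor>1 / s\<rfloor>" using s by (simp add: N_def)
    have "real N \<le> 1 / s" using N by simp
    then have N1: "real N * s \<le> 1" using s by (simp add: pos_le_divide_eq)
    have "1 / s < real (Suc N)" using N by (simp add: add.commute) linarith
    then have N2: "1 \<le> real (Suc N) * s" using s by (simp add: field_simps)
    have "N < J" using N1 False s by (smt (verit) mult_right_mono of_nat_mono not_le)
    define E where "E k = (\<Sum>j=Suc N..k. sin (real j * x))" for k
    have E: "\<bar>E k\<bar> \<le> 1 / s" for k
    proof -
      have "E k = Im (\<Sum>j=Suc N..k. cis (real j * x))" by (simp add: E_def)
      then have "\<bar>E k\<bar> \<le> cmod (\<Sum>j=Suc N..k. cis (real j * x))" by (simp only: abs_Im_le_cmod)
      also have "\<dots> \<le> 1 / s" using geometric_cis_bound[of x "Suc N" k] s by (simp add: s_def field_simps)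
      finally show ?thesis .
    qed
    have "(\<Sum>j=Suc N..J. 1 / real j * sin (real j * x))
        = 1 / real J * E J - (\<Sum>k=Suc N..<J. (1 / real (Suc k) - 1 / real k) * E k)"
      unfolding E_def by (rule sum_by_parts) (use \<open>N < J\<close> in auto)
    also have "\<bar>\<dots>\<bar> \<le> 1 / real J * (1 / s) + (\<Sum>k=Suc N..<J. (1 / real k - 1 / real (Suc k)) * (1 / s))"
    proof (rule order_trans[OF abs_triangle_ineq4], rule add_mono)
      show "\<bar>1 / real J * E J\<bar> \<le> 1 / real J * (1 / s)"
        unfolding abs_mult using E[of J] by (intro mult_mono) auto
      show "\<bar>\<Sum>k=Suc N..<J. (1 / real (Suc k) - 1 / real k) * E k\<bar> \<le> (\<Sum>k=Suc N..<J. (1 / real k - 1 / real (Suc k)) * (1 / s))"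
      proof (rule order_trans[OF sum_abs], rule sum_mono)
        fix k assume k: "k \<in> {Suc N..<J}"
        have "1 / real (Suc k) \<le> 1 / real k" using k by (simp add: frac_le)
        then have "\<bar>1 / real (Suc k) - 1 / real k\<bar> = 1 / real k - 1 / real (Suc k)" by simp
        then show "\<bar>(1 / real (Suc k) - 1 / real k) * E k\<bar> \<le> (1 / real k - 1 / real (Suc k)) * (1 / s)"
          unfolding abs_mult using E[of k] \<open>1 / real (Suc k) \<le> 1 / real k\<close>
          by (simp only:) (intro mult_left_mono, auto)
      qed
    qed
    also have "\<dots> = 1 / real J * (1 / s) + (1 / real (Suc N) - 1 / real J) * (1 / s)"
      using \<open>N < J\<close> sum_Suc_diff'[of "Suc N" J "\<lambda>k. - 1 / real k"]
      unfolding sum_distrib_right[symmetric] by simp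
    also have "\<dots> = 1 / (real (Suc N) * s)" by (simp add: algebra_simps)
    also have "\<dots> \<le> 1" using N2 by (simp add: divide_le_eq)
    finally have tail: "\<bar>\<Sum>j=Suc N..J. sin (real j * x) / real j\<bar> \<le> 1" by simp
    have "(\<Sum>j=1..J. sin (real j * x) / real j) = (\<Sum>j=1..N. sin (real j * x) / real j) + (\<Sum>j=Suc N..J. sin (real j * x) / real j)"
      using \<open>N < J\<close> sum.ub_add_nat[of 1 N "\<lambda>j. sin (real j * x) / real j" "J - N"] by simp
    then show ?thesis using tail head[of N] N1 by linarith
  qed
qed

text \<open>
  The sum on the left is, up to a factor of modulus \<open>1 / pi\<close>, the integral of \<open>g\<close> against
  \<open>cis (-m x) * (\<Sum>j\<le>J. sin (j x) / j)\<close>, a function bounded by \<open>3\<close>, and \<open>3 \<le> pi\<close>.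
\<close>

lemma sine_pairing:
  assumes g: "integrable circ g"
  shows "cmod (\<Sum>j=1..J. (fourier_coeff g (m + int j) - fourier_coeff g (m - int j)) / of_nat j) \<le> L_norm g"
proof -
  define \<phi> where "\<phi> x = (\<Sum>j=1..J. sin (real j * x) / real j)" for x
  define h where "h x = - 2 * \<i> * of_real (\<phi> x) * cis (- (of_int m * x))" for x
  have h_eq: "h x = (\<Sum>j=1..J. (cis (- (of_int (m + int j) * x)) - cis (- (of_int (m - int j) * x))) / of_nat j)" for x
  proof -
    have "(cis (- (of_int (m + int j) * x)) - cis (- (of_int (m - int j) * x))) / of_nat j
      = - 2 * \<i> * of_real (sin (real j * x) / real j) * cis (- (of_int m * x))" for j
    proof -
      have "cis (- (of_int (m + int j) * x)) = cis (- (of_int m * x)) * cis (- (real j * x))"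
           "cis (- (of_int (m - int j) * x)) = cis (- (of_int m * x)) * cis (real j * x)"
        by (simp_all add: cis_mult algebra_simps)
      moreover have "cis (- (real j * x)) - cis (real j * x) = - 2 * \<i> * of_real (sin (real j * x))"
        by (simp add: complex_eq_iff)
      ultimately have "cis (- (of_int (m + int j) * x)) - cis (- (of_int (m - int j) * x))
        = - 2 * \<i> * of_real (sin (real j * x)) * cis (- (of_int m * x))"
        by (metis mult.commute right_diff_distrib)
      then show ?thesis by simp
    qed
    then show ?thesis unfolding h_def \<phi>_def by (simp add: sum_distrib_left sum_distrib_right)
  qed
  have hm: "h \<in> borel_measurable circ"
    unfolding h_def[abs_def] \<phi>_def by (intro measurable_continuous_circ continuous_intros) auto
  have hb: "cmod (h x) \<le> 6" for x
    using sin_series_bounded[of x J, folded \<phi>_def] unfolding h_def norm_mult norm_of_real by simp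
  define C where "C j x = cis (- (of_int j * x))" for j :: int and x :: real
  have gC: "integrable circ (\<lambda>x. g x * C j x)" for j using g by (simp add: C_def)
  have gh: "g x * h x = (\<Sum>j=1..J. (g x * C (m + int j) x - g x * C (m - int j) x) / of_nat j)" for x
    unfolding h_eq C_def by (simp add: sum_distrib_left right_diff_distrib)
  have "(\<integral>x. g x * h x \<partial>circ) =
      (\<Sum>j=1..J. ((\<integral>x. g x * C (m + int j) x \<partial>circ) - (\<integral>x. g x * C (m - int j) x \<partial>circ)) / of_nat j)"
    unfolding gh using gC by (simp add: Bochner_Integration.integral_sum)
  then have "(\<Sum>j=1..J. (fourier_coeff g (m + int j) - fourier_coeff g (m - int j)) / of_nat j)
      = (\<integral>x. g x * h x \<partial>circ) / (2 * of_real pi)"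
    unfolding fourier_coeff_eq C_def by (simp add: sum_divide_distrib diff_divide_distrib mult.commute del: of_int_add of_int_diff)
  moreover have "cmod (\<integral>x. g x * h x \<partial>circ) \<le> (\<integral>x. 6 * cmod (g x) \<partial>circ)"
  proof (rule Bochner_Integration.integral_norm_bound_integral)
    show "integrable circ (\<lambda>x. g x * h x)" by (rule integrable_bounded_mult[OF g hm hb])
    show "cmod (g x * h x) \<le> 6 * cmod (g x)" for x
      using mult_right_mono[OF hb[of x], of "cmod (g x)"] by (simp add: norm_mult mult.commute)
  qed (use g in auto)
  ultimately have "cmod (\<Sum>j=1..J. (fourier_coeff g (m + int j) - fourier_coeff g (m - int j)) / of_nat j)
      \<le> 6 * L_norm g / (2 * pi)"
    unfolding L_norm_eq by (simp only: norm_divide) (simp add: divide_right_mono field_simps)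
  also have "\<dots> \<le> L_norm g"
    using pi_gt3 L_norm_nonneg[of g] mult_right_mono[of 6 "2*pi" "L_norm g"] by (simp add: divide_le_eq mult.commute)
  finally show ?thesis .
qed

text \<open>
  The block is bounded both by its length \<open>L\<close> and by \<open>pi / |x|\<close>. The function \<open>w\<close> below is twice the
  reciprocal of \<open>1 / L + |x| / pi\<close>, so it dominates the smaller of the two bounds and has an
  elementary primitive.
\<close>

lemma dirichlet_block_L1:
  assumes "p \<le> q"
  shows "L_norm (\<lambda>x. \<Sum>j=p..q. cis (real j * x)) \<le> 4 * pi * ln (2 + real q)"
proof -
  define L where "L = real (Suc q - p)"
  have L: "L \<ge> 1" using assms by (simp add: L_def)
  define w where "w x = 2 * pi * L / (pi + L * \<bar>x\<bar>)" for x
  have wc: "continuous_on UNIV w"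
    unfolding w_def[abs_def] using L by (intro continuous_intros) (smt (verit) abs_ge_zero mult_nonneg_nonneg pi_gt_zero)
  have pos: "((\<lambda>x. w x) has_integral 2 * pi * ln (1 + L)) {0..pi}"
  proof -
    have "(w has_integral 2 * pi * ln (pi + L * pi) - 2 * pi * ln (pi + L * 0)) {0..pi}"
    proof (rule fundamental_theorem_of_calculus)
      fix x :: real assume "x \<in> {0..pi}"
      then have "pi + L * x > 0" using L by (intro add_pos_nonneg) auto
      then show "((\<lambda>x. 2 * pi * ln (pi + L * x)) has_vector_derivative w x) (at x within {0..pi})"
        using \<open>x \<in> {0..pi}\<close>
        by (auto intro!: derivative_eq_intros simp: w_def has_real_derivative_iff_has_vector_derivative[symmetric])
    qed simp
    moreover have "2 * pi * ln (pi + L * pi) - 2 * pi * ln (pi + L * 0) = 2 * pi * ln (1 + L)"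
    proof -
      have "ln (pi + L * pi) = ln (pi * (1 + L))" by (simp add: algebra_simps)
      also have "\<dots> = ln pi + ln (1 + L)" using L by (intro ln_mult_pos) auto
      finally show ?thesis by (simp add: algebra_simps)
    qed
    ultimately show ?thesis by simp
  qed
  have "((\<lambda>x. w (- x)) has_integral 2 * pi * ln (1 + L)) {-pi..-0}"
    using pos by (subst has_integral_reflect_real)
  moreover have "(\<lambda>x. w (- x)) = w" by (simp add: w_def fun_eq_iff)
  ultimately have neg: "(w has_integral 2 * pi * ln (1 + L)) {-pi..0}"
    by simp
  have tot: "(w has_integral 4 * pi * ln (1 + L)) {-pi..pi}"
    using has_integral_combine[OF _ _ neg pos] by (simp add: mult.assoc)
  have wi: "integrable circ w"
    using integrable_bounded[of w "2 * L"] measurable_continuous_circ[OF wc]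
  proof -
    have "norm (w x) \<le> 2 * L" for x
    proof -
      have "pi + L * \<bar>x\<bar> \<ge> pi" using L by simp
      then have "2 * pi * L / (pi + L * \<bar>x\<bar>) \<le> 2 * pi * L / pi" 
        using L by (intro divide_left_mono) (auto intro!: mult_pos_pos add_pos_nonneg)
      moreover have "w x \<ge> 0" using L by (simp add: w_def)
      ultimately show ?thesis by (simp add: w_def)
    qed
    then show ?thesis by (rule integrable_bounded[OF measurable_continuous_circ[OF wc]])
  qed
  have ii: "integrable circ (\<lambda>x. \<Sum>j=p..q. cis (real j * x))" by auto
  have "L_norm (\<lambda>x. \<Sum>j=p..q. cis (real j * x)) \<le> (\<integral>x. w x \<partial>circ)"
    unfolding L_norm_eq
  proof (rule integral_mono)
    fix x assume "x \<in> space circ"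
    then have x: "\<bar>x\<bar> \<le> pi" by auto
    define D where "D = cmod (\<Sum>j=p..q. cis (real j * x))"
    have "D \<ge> 0" by (simp add: D_def)
    have D1: "D \<le> L" using norm_sum[of "\<lambda>j. cis (real j * x)" "{p..q}"] by (simp add: D_def L_def)
    have "\<bar>x\<bar> * D \<le> pi * \<bar>sin (x / 2)\<bar> * D"
      using sin_half_lower[OF x] \<open>D \<ge> 0\<close> by (intro mult_right_mono)
    also have "\<dots> \<le> pi * 1"
      unfolding mult.assoc D_def by (intro mult_left_mono geometric_cis_bound) auto
    finally have D2: "L * (\<bar>x\<bar> * D) \<le> L * pi" using L by (intro mult_left_mono) auto
    \<comment> \<open>The bounds D \<le> L and |x| D \<le> pi, scaled by pi and by L, add up to the bound by w.\<close>
    have "D * pi \<le> L * pi" using D1 by (intro mult_right_mono) auto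
    moreover have "D * (pi + L * \<bar>x\<bar>) = D * pi + L * (\<bar>x\<bar> * D)" by (simp add: algebra_simps)
    moreover have "2 * pi * L = L * pi + L * pi" by simp
    ultimately have "D * (pi + L * \<bar>x\<bar>) \<le> 2 * pi * L"
      using D2 by linarith
    moreover have "pi + L * \<bar>x\<bar> > 0" using L by (intro add_pos_nonneg) auto
    ultimately show "D \<le> w x" by (simp add: w_def le_divide_eq)
  qed (use ii wi in auto)
  also have "\<dots> = integral {-pi..pi} w" by (rule lebesgue_integral_eq_integral[OF wi]) simp
  also have "\<dots> = 4 * pi * ln (1 + L)" using tot by (rule integral_unique)
  also have "\<dots> \<le> 4 * pi * ln (2 + real q)"
    using L assms by (intro mult_left_mono ln_mono) (auto simp: L_def of_nat_diff)
  finally show ?thesis .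
qed

lemma L_norm_cnj: "L_norm (\<lambda>x. cnj (g x)) = L_norm g"
  by (simp add: L_norm_eq)

text \<open>
  Summation by parts reduces the coefficients to constants, for which the sums over blocks
  have norm \<open>O(log q)\<close>. The number \<open>2\<close> keeps the logarithm positive for all \<open>q\<close>.
\<close>

lemma block_L1:
  fixes c :: "nat \<Rightarrow> complex"
  assumes "p \<le> q"
  shows "L_norm (\<lambda>x. \<Sum>k=p..q. c k * cis (real k * x)) \<le>
    4 * pi * ln (2 + real q) * (cmod (c q) + (\<Sum>k=p..<q. cmod (c (Suc k) - c k)))"
proof -
  define E where "E k x = (\<Sum>j=p..k. cis (real j * x))" for k x
  have Ei: "integrable circ (E k)" for k by (auto simp: E_def[abs_def])
  have E: "L_norm (E k) \<le> 4 * pi * ln (2 + real q)" if "p \<le> k" "k \<le> q" for k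
  proof -
    have "L_norm (E k) \<le> 4 * pi * ln (2 + real k)" unfolding E_def by (rule dirichlet_block_L1[OF that(1)])
    also have "\<dots> \<le> 4 * pi * ln (2 + real q)" using that by (intro mult_left_mono ln_mono) auto
    finally show ?thesis .
  qed
  have "L_norm (\<lambda>x. \<Sum>k=p..q. c k * cis (real k * x)) = L_norm (\<lambda>x. c q * E q x + (\<Sum>k=p..<q. - (c (Suc k) - c k) * E k x))"
    unfolding sum_by_parts[OF assms] E_def mult_minus_left sum_negf by (simp only: add_uminus_conv_diff)
  also have "\<dots> \<le> L_norm (\<lambda>x. c q * E q x) + L_norm (\<lambda>x. \<Sum>k=p..<q. - (c (Suc k) - c k) * E k x)"
    by (intro L_norm_triangle integrable_mult_right Bochner_Integration.integrable_sum Ei)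
  also have "\<dots> \<le> L_norm (\<lambda>x. c q * E q x) + (\<Sum>k=p..<q. L_norm (\<lambda>x. - (c (Suc k) - c k) * E k x))"
    by (intro add_left_mono L_norm_sum integrable_mult_right Ei)
  also have "\<dots> = cmod (c q) * L_norm (E q) + (\<Sum>k=p..<q. cmod (c (Suc k) - c k) * L_norm (E k))"
    unfolding L_norm_cmult norm_minus_cancel ..
  also have "\<dots> \<le> cmod (c q) * (4 * pi * ln (2 + real q)) + (\<Sum>k=p..<q. cmod (c (Suc k) - c k) * (4 * pi * ln (2 + real q)))"
    using assms by (intro add_mono sum_mono mult_left_mono E) auto
  also have "\<dots> = 4 * pi * ln (2 + real q) * (cmod (c q) + (\<Sum>k=p..<q. cmod (c (Suc k) - c k)))"
    by (simp only: sum_distrib_right[symmetric] distrib_left mult.commute)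
  finally show ?thesis .
qed

lemma block_L1_minus:
  fixes c :: "nat \<Rightarrow> complex"
  assumes "p \<le> q"
  shows "L_norm (\<lambda>x. \<Sum>k=p..q. c k * cis (- (real k * x))) \<le>
    4 * pi * ln (2 + real q) * (cmod (c q) + (\<Sum>k=p..<q. cmod (c (Suc k) - c k)))"
proof -
  have "L_norm (\<lambda>x. \<Sum>k=p..q. c k * cis (- (real k * x)))
     = L_norm (\<lambda>x. cnj (\<Sum>k=p..q. cnj (c k) * cis (real k * x)))"
    by (simp add: cnj_sum cis_cnj)
  also have "\<dots> \<le> 4 * pi * ln (2 + real q) * (cmod (cnj (c q)) + (\<Sum>k=p..<q. cmod (cnj (c (Suc k)) - cnj (c k))))"
    unfolding L_norm_cnj by (rule block_L1[OF assms])
  also have "\<dots> = 4 * pi * ln (2 + real q) * (cmod (c q) + (\<Sum>k=p..<q. cmod (c (Suc k) - c k)))"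
    by (simp flip: complex_cnj_diff)
  finally show ?thesis .
qed

section \<open>Logarithmic decay of coefficient sequences\<close>

definition log_null :: "(nat \<Rightarrow> complex) \<Rightarrow> bool" where
  "log_null c \<longleftrightarrow> (\<lambda>n. cmod (c n) * ln (real n)) \<longlonglongrightarrow> 0"

text \<open>
  The limsup hypothesis of the theorem for \<open>d = a - b\<close>, freed of extended reals and with \<open>\<mu> \<le> 2\<close>, so that
  \<open>[n, \<mu> n]\<close> stays inside the range \<open>[n, 2 n]\<close> of the MVBV inequality.
\<close>

definition slowly_varying :: "(nat \<Rightarrow> complex) \<Rightarrow> bool" where
  "slowly_varying d \<longleftrightarrow> (\<forall>\<epsilon>>0. \<exists>\<mu>>1. \<mu> \<le> 2 \<and>
     (\<forall>\<^sub>F n in sequentially. (\<Sum>k=n..nat \<lfloor>\<mu> * real n\<rfloor>. cmod (d (Suc k) - d k) * ln (real k)) \<le> \<epsilon>))"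

text \<open>
  Decay of \<open>a k log k\<close> in the mean over long intervals. It is available in both directions of the
  theorem, for different reasons, and is all that the MVBV inequality needs. The argument
  \<open>k / 2\<close> of the logarithm is the form in which the harmonic numbers of \<open>k div 2\<close> provide it.
\<close>

definition small_log_mass :: "(nat \<Rightarrow> complex) \<Rightarrow> bool" where
  "small_log_mass a \<longleftrightarrow> (\<forall>\<epsilon>>0. \<forall>\<^sub>F A in sequentially. \<forall>B.
     (\<Sum>k=A..B. cmod (a k) * ln (real k / 2)) \<le> \<epsilon> * (real B + 1))"

lemma tendsto_int_iff_log_null:
  "((\<lambda>n::int. c n * of_real (ln (real_of_int \<bar>n\<bar>))) \<longlongrightarrow> (0::complex)) (filtercomap abs at_top)
    \<longleftrightarrow> log_null (\<lambda>n. c (int n)) \<and> log_null (\<lambda>n. c (- int n))" (is "?L \<longleftrightarrow> ?R")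
proof
  assume L: ?L
  have lim: "filterlim (\<lambda>n. int n) (filtercomap abs at_top) sequentially"
       "filterlim (\<lambda>n. - int n) (filtercomap abs at_top) sequentially"
    using filterlim_int_sequentially by (simp_all add: filterlim_filtercomap_iff o_def)
  have "((\<lambda>n. c (int n) * of_real (ln (real_of_int \<bar>int n\<bar>))) \<longlongrightarrow> 0) sequentially"
    using filterlim_compose[OF L lim(1)] .
  moreover have "((\<lambda>n. c (- int n) * of_real (ln (real_of_int \<bar>- int n\<bar>))) \<longlongrightarrow> 0) sequentially"
    using filterlim_compose[OF L lim(2)] .
  moreover have "cmod (z * of_real (ln (real n))) = cmod z * ln (real n)" for z n
    by (cases n) (auto simp: norm_mult)
  ultimately show ?R unfolding log_null_def by (auto dest: tendsto_norm)
next
  assume R: ?R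
  show ?L
  proof (rule tendstoI)
    fix e :: real assume e: "e > 0"
    have "\<forall>\<^sub>F n in sequentially. cmod (c (int n)) * ln (real n) < e \<and> cmod (c (- int n)) * ln (real n) < e"
      using R order_tendstoD(2) e unfolding log_null_def by (intro eventually_conj) blast+
    then obtain N where N: "\<And>n. n \<ge> N \<Longrightarrow> cmod (c (int n)) * ln (real n) < e \<and> cmod (c (- int n)) * ln (real n) < e"
      by (auto simp: eventually_sequentially)
    have "dist (c k * of_real (ln (real_of_int \<bar>k\<bar>))) 0 < e" if k: "\<bar>k\<bar> \<ge> max 1 (int N)" for k
    proof -
      define n where "n = nat \<bar>k\<bar>"
      have n: "n \<ge> N" "n \<ge> 1" and r: "real_of_int \<bar>k\<bar> = real n" using k by (auto simp: n_def)
      have "k = int n \<or> k = - int n" by (auto simp: n_def)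
      then have "cmod (c k) * ln (real n) < e" using N[OF n(1)] by auto
      then show ?thesis using n by (simp add: r norm_mult del: of_int_abs)
    qed
    then show "\<forall>\<^sub>F k in filtercomap abs at_top. dist (c k * of_real (ln (real_of_int \<bar>k\<bar>))) 0 < e"
      unfolding eventually_filtercomap eventually_at_top_linorder by blast
  qed
qed

lemma slowly_varying_of_limsup:
  assumes "((\<lambda>\<mu>::real. limsup (\<lambda>n::nat. ereal (\<Sum>k=n..nat \<lfloor>\<mu> * real n\<rfloor>.
             cmod (d (Suc k) - d k) * ln (real k)))) \<longlongrightarrow> 0) (at_right 1)"
  shows "slowly_varying d"
  unfolding slowly_varying_def
proof (intro allI impI)
  fix \<epsilon> :: real assume "\<epsilon> > 0"
  then have "\<forall>\<^sub>F \<mu> in at_right 1. limsup (\<lambda>n::nat. ereal (\<Sum>k=n..nat \<lfloor>\<mu> * real n\<rfloor>.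
             cmod (d (Suc k) - d k) * ln (real k))) < ereal \<epsilon>"
    using order_tendstoD(2)[OF assms, of "ereal \<epsilon>"] by simp
  moreover have "\<forall>\<^sub>F \<mu> in at_right (1::real). \<mu> \<in> {1<..<2}"
    by (rule eventually_at_right_real) simp
  ultimately have "\<forall>\<^sub>F \<mu> in at_right 1. limsup (\<lambda>n::nat. ereal (\<Sum>k=n..nat \<lfloor>\<mu> * real n\<rfloor>.
             cmod (d (Suc k) - d k) * ln (real k))) < ereal \<epsilon> \<and> \<mu> \<in> {1<..<2}"
    by (rule eventually_conj)
  then obtain \<mu> where \<mu>: "\<mu> \<in> {1<..<2}" and
    ls: "limsup (\<lambda>n::nat. ereal (\<Sum>k=n..nat \<lfloor>\<mu> * real n\<rfloor>. cmod (d (Suc k) - d k) * ln (real k))) < ereal \<epsilon>"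
    using eventually_happens[of _ "at_right (1::real)"] trivial_limit_at_right_real[of 1] by blast
  have "\<forall>\<^sub>F n in sequentially. ereal (\<Sum>k=n..nat \<lfloor>\<mu> * real n\<rfloor>. cmod (d (Suc k) - d k) * ln (real k)) < ereal \<epsilon>"
    by (rule Limsup_lessD[OF ls])
  then have "\<forall>\<^sub>F n in sequentially. (\<Sum>k=n..nat \<lfloor>\<mu> * real n\<rfloor>. cmod (d (Suc k) - d k) * ln (real k)) \<le> \<epsilon>"
    by eventually_elim simp
  then show "\<exists>\<mu>>1. \<mu> \<le> 2 \<and> (\<forall>\<^sub>F n in sequentially. (\<Sum>k=n..nat \<lfloor>\<mu> * real n\<rfloor>. cmod (d (Suc k) - d k) * ln (real k)) \<le> \<epsilon>)"
    using \<mu> by (intro exI[of _ \<mu>]) auto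
qed

lemma sector_Re_lower:
  assumes "z \<in> sector \<theta>" "\<theta> < pi / 2"
  shows "cos \<theta> * cmod z \<le> Re z"
proof (cases "z = 0")
  case False
  then have arg: "\<bar>Arg z\<bar> \<le> \<theta>" using assms by (simp add: sector_def)
  have "cos \<theta> \<le> cos \<bar>Arg z\<bar>"
    by (rule cos_monotone_0_pi_le) (use arg assms pi_gt_zero in auto)
  also have "\<dots> = Re z / cmod z" using False by (simp add: cos_Arg)
  finally show ?thesis using False by (simp add: field_simps)
qed simp

lemma small_log_mass_of_log_null:
  assumes "log_null a"
  shows "small_log_mass a"
  unfolding small_log_mass_def
proof (intro allI impI)
  fix \<epsilon> :: real assume "\<epsilon> > 0"
  then have "\<forall>\<^sub>F n in sequentially. cmod (a n) * ln (real n) < \<epsilon>"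
    using assms order_tendstoD(2) unfolding log_null_def by blast
  then obtain n0 where n0: "\<And>n. n \<ge> n0 \<Longrightarrow> cmod (a n) * ln (real n) < \<epsilon>"
    by (auto simp: eventually_sequentially)
  show "\<forall>\<^sub>F A in sequentially. \<forall>B. (\<Sum>k=A..B. cmod (a k) * ln (real k / 2)) \<le> \<epsilon> * (real B + 1)"
    unfolding eventually_sequentially
  proof (intro exI[of _ "max n0 1"] allI impI)
    fix A B assume A: "A \<ge> max n0 1"
    have "(\<Sum>k=A..B. cmod (a k) * ln (real k / 2)) \<le> (\<Sum>k=A..B. \<epsilon>)"
    proof (rule sum_mono)
      fix k assume k: "k \<in> {A..B}"
      have "cmod (a k) * ln (real k / 2) \<le> cmod (a k) * ln (real k)"
        using k A by (intro mult_left_mono ln_mono) auto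
      also have "\<dots> \<le> \<epsilon>" using n0[of k] k A by simp
      finally show "cmod (a k) * ln (real k / 2) \<le> \<epsilon>" .
    qed
    also have "\<dots> = \<epsilon> * real (Suc B - A)" by simp
    also have "\<dots> \<le> \<epsilon> * (real B + 1)" using \<open>\<epsilon> > 0\<close> by (intro mult_left_mono) auto
    finally show "(\<Sum>k=A..B. cmod (a k) * ln (real k / 2)) \<le> \<epsilon> * (real B + 1)" .
  qed
qed

text \<open>
  In a sector the modulus is at most a constant times the real part, so the hypothesis also holds
  with \<open>|a (n + j)|\<close>. Summing it over \<open>n\<close> and collecting the terms with \<open>n + j = k\<close> gives
  \<open>|a k|\<close> the weight \<open>\<Sum>j\<le>k / 2. 1 / j\<close>, which is at least \<open>ln (k / 2)\<close>.
\<close>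

lemma small_log_mass_of_sector:
  assumes th: "0 \<le> \<theta>" "\<theta> < pi / 2" and sec: "\<And>n. a n \<in> sector \<theta>"
    and H: "(\<lambda>n. cmod (\<Sum>j=1..n. a (n + j) / of_nat j)) \<longlonglongrightarrow> 0"
  shows "small_log_mass a"
  unfolding small_log_mass_def
proof (intro allI impI)
  fix \<epsilon> :: real assume "\<epsilon> > 0"
  have c: "cos \<theta> > 0" using th by (intro cos_gt_zero_pi) auto
  then have "\<epsilon> * cos \<theta> > 0" using \<open>\<epsilon> > 0\<close> by simp
  then obtain n0 where n0: "\<And>n. n \<ge> n0 \<Longrightarrow> cmod (\<Sum>j=1..n. a (n + j) / of_nat j) < \<epsilon> * cos \<theta>"
    using order_tendstoD(2)[OF H] by (fastforce simp: eventually_sequentially)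
  have abs_sum: "(\<Sum>j=1..n. cmod (a (n + j)) / real j) \<le> \<epsilon>" if "n \<ge> n0" for n
  proof -
    have "cos \<theta> * (\<Sum>j=1..n. cmod (a (n + j)) / real j) = (\<Sum>j=1..n. cos \<theta> * cmod (a (n + j)) / real j)"
      by (simp add: sum_distrib_left)
    also have "\<dots> \<le> (\<Sum>j=1..n. Re (a (n + j)) / real j)"
      using sector_Re_lower[OF sec th(2)] by (intro sum_mono divide_right_mono) auto
    also have "\<dots> = Re (\<Sum>j=1..n. a (n + j) / of_nat j)" by simp
    also have "\<dots> \<le> cmod (\<Sum>j=1..n. a (n + j) / of_nat j)" by (rule complex_Re_le_cmod)
    also have "\<dots> \<le> cos \<theta> * \<epsilon>" using n0[OF that] by (simp add: mult.commute)
    finally show ?thesis using c by simp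
  qed
  show "\<forall>\<^sub>F A in sequentially. \<forall>B. (\<Sum>k=A..B. cmod (a k) * ln (real k / 2)) \<le> \<epsilon> * (real B + 1)"
    unfolding eventually_sequentially
  proof (intro exI[of _ "2 * n0 + 1"] allI impI)
    fix A B assume A: "A \<ge> 2 * n0 + 1"
    have "(\<Sum>k=A..B. cmod (a k) * ln (real k / 2)) \<le> (\<Sum>k=A..B. \<Sum>i=1..k div 2. cmod (a k) / real i)"
    proof (rule sum_mono)
      fix k assume k: "k \<in> {A..B}"
      have "ln (real k / 2) \<le> ln (real (k div 2) + 1)"
      proof (rule ln_mono)
        show "real k / 2 > 0" using k A by auto
        have "k \<le> 2 * (k div 2) + 1" by linarith
        then have "real k \<le> real (2 * (k div 2) + 1)" by (simp only: of_nat_le_iff)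
        then show "real k / 2 \<le> real (k div 2) + 1" by simp
      qed
      also have "\<dots> \<le> harm (k div 2)" by (rule ln_le_harm)
      finally have "cmod (a k) * ln (real k / 2) \<le> cmod (a k) * harm (k div 2)"
        by (intro mult_left_mono) auto
      also have "\<dots> = (\<Sum>i=1..k div 2. cmod (a k) / real i)"
        by (simp add: harm_def sum_distrib_left divide_inverse)
      finally show "cmod (a k) * ln (real k / 2) \<le> (\<Sum>i=1..k div 2. cmod (a k) / real i)" .
    qed
    also have "\<dots> = (\<Sum>(k, i)\<in>Sigma {A..B} (\<lambda>k. {1..k div 2}). cmod (a k) / real i)"
      by (simp add: sum.Sigma)
    \<comment> \<open>For i at most k / 2 the pair (k - i, i) satisfies i \<le> k - i, so it occurs in the sums over n.\<close>
    also have "\<dots> = (\<Sum>(n, j)\<in>(\<lambda>(k, i). (k - i, i)) ` Sigma {A..B} (\<lambda>k. {1..k div 2}). cmod (a (n + j)) / real j)"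
      by (subst sum.reindex) (auto simp: inj_on_def intro!: sum.cong)
    also have "\<dots> \<le> (\<Sum>(n, j)\<in>Sigma {n0..B} (\<lambda>n. {1..n}). cmod (a (n + j)) / real j)"
      by (rule sum_mono2) (use A in auto)
    also have "\<dots> = (\<Sum>n=n0..B. \<Sum>j=1..n. cmod (a (n + j)) / real j)"
      by (simp add: sum.Sigma)
    also have "\<dots> \<le> (\<Sum>n=n0..B. \<epsilon>)" by (intro sum_mono abs_sum) auto
    also have "\<dots> = \<epsilon> * real (Suc B - n0)" by simp
    also have "\<dots> \<le> \<epsilon> * (real B + 1)" using \<open>\<epsilon> > 0\<close> by (intro mult_left_mono) auto
    finally show "(\<Sum>k=A..B. cmod (a k) * ln (real k / 2)) \<le> \<epsilon> * (real B + 1)" .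
  qed
qed

text \<open>
  On the window \<open>[m / \<lambda>, \<lambda> m]\<close> all logarithms are comparable with \<open>ln m\<close>, so the weights can be
  pulled out of the sum.
\<close>

lemma log_mean_tendsto_0:
  assumes W: "small_log_mass a" and lam: "lam \<ge> 2"
  shows "(\<lambda>m. ln (real m) / real m * (\<Sum>k=nat \<lfloor>real m / lam\<rfloor>..nat \<lfloor>lam * real m\<rfloor>. cmod (a k))) \<longlonglongrightarrow> 0"
    (is "?X \<longlonglongrightarrow> 0")
proof (rule order_tendstoI)
  fix e :: real assume "e < 0"
  then show "\<forall>\<^sub>F m in sequentially. e < ?X m"
    by (intro eventually_sequentiallyI[of 1] less_le_trans[OF _ mult_nonneg_nonneg] divide_nonneg_nonneg
        ln_ge_zero sum_nonneg) auto
next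
  fix e :: real assume "e > 0"
  define \<epsilon> where "\<epsilon> = e / (4 * (lam + 1))"
  have \<epsilon>: "\<epsilon> > 0" using \<open>e > 0\<close> lam by (simp add: \<epsilon>_def)
  obtain n0 where n0: "\<And>A B. A \<ge> n0 \<Longrightarrow> (\<Sum>k=A..B. cmod (a k) * ln (real k / 2)) \<le> \<epsilon> * (real B + 1)"
    using W \<epsilon> unfolding small_log_mass_def eventually_sequentially by blast
  \<comment> \<open>Beyond m0 the lower end A of the window is at least n0 and satisfies A / 2 \<ge> sqrt m, hence ln (A / 2) \<ge> ln m / 2.\<close>
  define m0 where "m0 = nat \<lceil>max (16 * lam\<^sup>2) (lam * (real n0 + 1))\<rceil>"
  show "\<forall>\<^sub>F m in sequentially. ?X m < e"
  proof (rule eventually_sequentiallyI)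
    fix m assume m: "m \<ge> m0"
    have "real m \<ge> real m0" using m by simp
    moreover have "real m0 \<ge> max (16 * lam\<^sup>2) (lam * (real n0 + 1))"
      unfolding m0_def by (rule real_nat_ceiling_ge)
    ultimately have m1: "real m \<ge> 16 * lam\<^sup>2" and m2: "real m \<ge> lam * (real n0 + 1)" by auto
    have lamsq: "lam\<^sup>2 \<ge> 2 * lam" using lam by (simp add: power2_eq_square)
    have m3: "real m \<ge> 32 * lam" using m1 lamsq by linarith
    then have m4: "real m \<ge> 64" using lam by linarith
    define A where "A = nat \<lfloor>real m / lam\<rfloor>"
    define B where "B = nat \<lfloor>lam * real m\<rfloor>"
    have A1: "real A > real m / lam - 1"
    proof -
      have "real m / lam \<ge> 0" using lam by simp
      then show ?thesis unfolding A_def by simp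
    qed
    have "real m / lam \<ge> real n0 + 1" using m2 lam by (simp add: field_simps)
    then have "A \<ge> n0" using A1 by linarith
    have B1: "real B \<le> lam * real m" using lam by (simp add: B_def)
    have A2: "real A / 2 \<ge> sqrt (real m)"
    proof -
      have "real m / lam \<ge> 2" using m3 lam by (simp add: field_simps)
      then have "real A \<ge> real m / (2 * lam)" using A1 by (simp add: field_simps)
      have "4 * lam \<le> sqrt (real m)" using m1 lam by (intro real_le_rsqrt) (simp add: power_mult_distrib)
      then have "4 * lam * sqrt (real m) \<le> sqrt (real m) * sqrt (real m)" by (intro mult_right_mono) auto
      then have "4 * lam * sqrt (real m) \<le> real m" by simp
      then have "sqrt (real m) \<le> real m / (4 * lam)" using lam by (simp add: field_simps)
      with \<open>real A \<ge> real m / (2 * lam)\<close> show ?thesis by (simp add: field_simps)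
    qed
    define S where "S = (\<Sum>k=A..B. cmod (a k))"
    have "S * (ln (real m) / 2) = (\<Sum>k=A..B. cmod (a k) * (ln (real m) / 2))"
      by (simp add: S_def sum_distrib_right)
    also have "\<dots> \<le> (\<Sum>k=A..B. cmod (a k) * ln (real k / 2))"
    proof (intro sum_mono mult_left_mono)
      fix k assume "k \<in> {A..B}"
      then have "sqrt (real m) \<le> real k / 2" using A2 by auto
      then have "ln (sqrt (real m)) \<le> ln (real k / 2)" using m4 by (intro ln_mono) auto
      then show "ln (real m) / 2 \<le> ln (real k / 2)" using m4 by (simp add: ln_sqrt)
    qed auto
    also have "\<dots> \<le> \<epsilon> * (real B + 1)" by (rule n0[OF \<open>A \<ge> n0\<close>])
    also have "\<dots> \<le> \<epsilon> * ((lam + 1) * real m)"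
    proof (intro mult_left_mono)
      show "real B + 1 \<le> (lam + 1) * real m" using B1 m4 by (simp add: distrib_right)
    qed (use \<epsilon> in auto)
    also have "\<dots> = e / 4 * real m" using lam by (simp add: \<epsilon>_def field_simps)
    finally have "S * ln (real m) \<le> e / 2 * real m" by simp
    then have "ln (real m) / real m * S \<le> e / 2" using m4 by (simp add: field_simps)
    then show "?X m < e" using \<open>e > 0\<close> unfolding S_def A_def B_def by linarith
  qed
qed

text \<open>
  The MVBV inequality bounds the variation over \<open>[m, 2 m]\<close> by the mean of \<open>|a|\<close>. Conversely \<open>|a m|\<close>
  exceeds the mean over \<open>[m, 2 m)\<close> by at most that variation, so decay in the mean becomes
  pointwise decay.
\<close>

lemma MVBVS_consequences:
  assumes a: "a \<in> MVBVS" and W: "small_log_mass a"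
  shows MVBVS_log_variation: "(\<lambda>m. ln (real m) * (\<Sum>k=m..2*m. cmod (a (Suc k) - a k))) \<longlonglongrightarrow> 0"
    and MVBVS_log_null: "log_null a"
proof -
  obtain lam C where lam: "lam \<ge> 2" and C: "C > 0"
    and bv: "\<And>m. m \<ge> 1 \<Longrightarrow> (\<Sum>k=m..2*m. cmod (a (k + 1) - a k)) \<le>
       C / real m * (\<Sum>k=nat \<lfloor>real m / lam\<rfloor>..nat \<lfloor>lam * real m\<rfloor>. cmod (a k))"
    using a unfolding MVBVS_def by blast
  define S where "S m = (\<Sum>k=nat \<lfloor>real m / lam\<rfloor>..nat \<lfloor>lam * real m\<rfloor>. cmod (a k))" for m
  define V where "V m = (\<Sum>k=m..2*m. cmod (a (Suc k) - a k))" for m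
  have S: "(\<lambda>m. ln (real m) / real m * S m) \<longlonglongrightarrow> 0"
    unfolding S_def by (rule log_mean_tendsto_0[OF W lam])
  have V0: "V m \<ge> 0" for m by (simp add: V_def sum_nonneg)
  have "(\<lambda>m. ln (real m) * V m) \<longlonglongrightarrow> 0"
  proof (rule Lim_null_comparison)
    show "(\<lambda>m. C * (ln (real m) / real m * S m)) \<longlonglongrightarrow> 0"
      using tendsto_mult_right_zero[OF S] by simp
    show "\<forall>\<^sub>F m in sequentially. norm (ln (real m) * V m) \<le> C * (ln (real m) / real m * S m)"
    proof (rule eventually_sequentiallyI[of 1])
      fix m :: nat assume m: "m \<ge> 1"
      have "ln (real m) * V m \<le> ln (real m) * (C / real m * S m)"
        using bv[OF m] m by (intro mult_left_mono) (auto simp: V_def S_def)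
      then show "norm (ln (real m) * V m) \<le> C * (ln (real m) / real m * S m)"
        using V0[of m] m by (simp add: mult_ac)
    qed
  qed
  then show V: "(\<lambda>m. ln (real m) * (\<Sum>k=m..2*m. cmod (a (Suc k) - a k))) \<longlonglongrightarrow> 0"
    by (simp add: V_def)
  show "log_null a"
    unfolding log_null_def
  proof (rule Lim_null_comparison)
    show "(\<lambda>m. ln (real m) / real m * S m + ln (real m) * V m) \<longlonglongrightarrow> 0"
      using tendsto_add[OF S V] by (simp add: V_def)
    show "\<forall>\<^sub>F m in sequentially. norm (cmod (a m) * ln (real m)) \<le> ln (real m) / real m * S m + ln (real m) * V m"
    proof (rule eventually_sequentiallyI[of 1])
      fix m :: nat assume m: "m \<ge> 1"
      have step: "cmod (a m) \<le> cmod (a k) + V m" if k: "k \<in> {m..<2*m}" for k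
      proof -
        have "cmod (a k - a m) = cmod (\<Sum>i=m..<k. a (Suc i) - a i)"
          using k by (subst sum_Suc_diff') auto
        also have "\<dots> \<le> (\<Sum>i=m..<k. cmod (a (Suc i) - a i))" by (rule norm_sum)
        also have "\<dots> \<le> V m" unfolding V_def using k by (intro sum_mono2) auto
        finally show ?thesis using norm_triangle_sub[of "a m" "a k"] by (simp add: norm_minus_commute)
      qed
      have "real m * cmod (a m) = (\<Sum>k=m..<2*m. cmod (a m))" by simp
      also have "\<dots> \<le> (\<Sum>k=m..<2*m. cmod (a k) + V m)" by (intro sum_mono step)
      also have "\<dots> = (\<Sum>k=m..<2*m. cmod (a k)) + real m * V m" by (simp add: sum.distrib)
      also have "(\<Sum>k=m..<2*m. cmod (a k)) \<le> S m"
        unfolding S_def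
      proof (rule sum_mono2)
        have "real m / lam \<le> real m" using lam m by (simp add: divide_le_eq mult_le_cancel_left1)
        then have "nat \<lfloor>real m / lam\<rfloor> \<le> m" by linarith
        moreover have "2 * real m \<le> lam * real m" using lam by (intro mult_right_mono) auto
        then have "2 * m \<le> nat \<lfloor>lam * real m\<rfloor>" by linarith
        ultimately show "{m..<2*m} \<subseteq> {nat \<lfloor>real m / lam\<rfloor>..nat \<lfloor>lam * real m\<rfloor>}" by auto
      qed auto
      finally have "cmod (a m) \<le> S m / real m + V m" using m by (simp add: field_simps)
      then have "ln (real m) * cmod (a m) \<le> ln (real m) * (S m / real m + V m)"
        using m by (intro mult_left_mono) auto
      then show "norm (cmod (a m) * ln (real m)) \<le> ln (real m) / real m * S m + ln (real m) * V m"
        using m by (simp add: algebra_simps)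
    qed
  qed
qed

text \<open>
  On \<open>[n, \<mu> n]\<close> the sequence differs from \<open>d n\<close> by at most \<open>\<epsilon> / log n\<close>, so the sum with
  \<open>J = (\<mu> - 1) n\<close> terms is close to \<open>d n\<close> times the harmonic number of \<open>J\<close>, which is at least
  half of \<open>log n\<close> for large \<open>n\<close>.
\<close>

lemma slowly_varying_log_null:
  assumes sv: "slowly_varying d"
    and H: "\<And>\<epsilon>. \<epsilon> > 0 \<Longrightarrow> \<forall>\<^sub>F n in sequentially. \<forall>J\<le>n. cmod (\<Sum>j=1..J. d (n + j) / of_nat j) \<le> \<epsilon>"
  shows "log_null d"
  unfolding log_null_def
proof (rule order_tendstoI)
  fix e :: real assume "e < 0"
  then show "\<forall>\<^sub>F n in sequentially. e < cmod (d n) * ln (real n)"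
    by (intro eventually_sequentiallyI[of 1]) (auto intro!: less_le_trans[OF _ mult_nonneg_nonneg])
next
  fix e :: real assume "e > 0"
  define \<epsilon> where "\<epsilon> = e / 4"
  have \<epsilon>: "\<epsilon> > 0" using \<open>e > 0\<close> by (simp add: \<epsilon>_def)
  obtain \<mu> where \<mu>: "\<mu> > 1" "\<mu> \<le> 2" and
    ev: "\<forall>\<^sub>F n in sequentially. (\<Sum>k=n..nat \<lfloor>\<mu> * real n\<rfloor>. cmod (d (Suc k) - d k) * ln (real k)) \<le> \<epsilon>"
    using sv \<epsilon> unfolding slowly_varying_def by blast
  \<comment> \<open>This size of n makes (\<mu> - 1) n at least sqrt n, hence the harmonic number at least ln n / 2.\<close>
  have big: "\<forall>\<^sub>F n in sequentially. real n \<ge> max 2 (1 / (\<mu> - 1)\<^sup>2)"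
    using filterlim_real_sequentially unfolding filterlim_at_top by blast
  show "\<forall>\<^sub>F n in sequentially. cmod (d n) * ln (real n) < e"
    using ev H[OF \<epsilon>] big
  proof eventually_elim
    case (elim n)
    have n2: "real n \<ge> 2" using elim(3) by simp
    then have lnp: "ln (real n) > 0" by simp
    define J where "J = nat \<lfloor>(\<mu> - 1) * real n\<rfloor>"
    have Jle: "real J \<le> (\<mu> - 1) * real n" using \<mu> by (simp add: J_def)
    have Jge: "real J + 1 \<ge> (\<mu> - 1) * real n" using \<mu> unfolding J_def by linarith
    have "(\<mu> - 1) * real n \<le> 1 * real n" using \<mu> by (intro mult_right_mono) auto
    then have "J \<le> n" using Jle by simp
    define h :: real where "h = harm J"
    have harm: "h \<ge> ln (real n) / 2"
    proof -
      have "1 / (\<mu> - 1)\<^sup>2 \<le> real n" using elim(3) by simp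
      then have "1 \<le> real n * (\<mu> - 1)\<^sup>2" using \<mu> by (simp add: pos_divide_le_eq)
      then have "real n * 1 \<le> real n * (real n * (\<mu> - 1)\<^sup>2)" by (intro mult_left_mono) auto
      then have "real n \<le> ((\<mu> - 1) * real n)\<^sup>2" by (simp add: power2_eq_square mult_ac)
      then have "sqrt (real n) \<le> (\<mu> - 1) * real n" using \<mu> by (intro real_le_lsqrt) auto
      then have "ln (sqrt (real n)) \<le> ln (real J + 1)" using Jge n2 by (intro ln_mono) auto
      also have "\<dots> \<le> h" unfolding h_def by (rule ln_le_harm)
      finally show ?thesis using n2 by (simp add: ln_sqrt)
    qed
    then have hpos: "h > 0" using lnp by linarith
    have close: "cmod (d (n + j) - d n) * ln (real n) \<le> \<epsilon>" if j: "j \<le> J" for j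
    proof -
      have "cmod (d (n + j) - d n) = cmod (\<Sum>k=n..<n+j. d (Suc k) - d k)"
        by (subst sum_Suc_diff') auto
      also have "\<dots> \<le> (\<Sum>k=n..<n+j. cmod (d (Suc k) - d k))" by (rule norm_sum)
      finally have "cmod (d (n + j) - d n) * ln (real n) \<le> (\<Sum>k=n..<n+j. cmod (d (Suc k) - d k)) * ln (real n)"
        using lnp by (intro mult_right_mono) auto
      also have "\<dots> \<le> (\<Sum>k=n..<n+j. cmod (d (Suc k) - d k) * ln (real k))"
        unfolding sum_distrib_right using n2 by (intro sum_mono mult_left_mono ln_mono) auto
      also have "\<dots> \<le> (\<Sum>k=n..nat \<lfloor>\<mu> * real n\<rfloor>. cmod (d (Suc k) - d k) * ln (real k))"
      proof (rule sum_mono2)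
        have "real (n + j) \<le> \<mu> * real n" using j Jle by (simp add: algebra_simps)
        then have "n + j \<le> nat \<lfloor>\<mu> * real n\<rfloor>" by linarith
        then show "{n..<n+j} \<subseteq> {n..nat \<lfloor>\<mu> * real n\<rfloor>}" by auto
        show "0 \<le> cmod (d (Suc k) - d k) * ln (real k)"
          if "k \<in> {n..nat \<lfloor>\<mu> * real n\<rfloor>} - {n..<n+j}" for k
          using that n2 by (intro mult_nonneg_nonneg) auto
      qed simp
      finally show ?thesis using elim(1) by linarith
    qed
    have hsum: "of_real (h) = (\<Sum>j=1..J. 1 / of_nat j :: complex)"
      by (simp add: h_def harm_def divide_inverse)
    have "of_real (h) * d n = (\<Sum>j=1..J. d (n + j) / of_nat j) - (\<Sum>j=1..J. (d (n + j) - d n) / of_nat j)"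
      unfolding hsum sum_distrib_right sum_subtractf[symmetric] by (intro sum.cong) (auto simp: field_simps)
    then have "cmod (of_real (h) * d n) \<le> cmod (\<Sum>j=1..J. d (n + j) / of_nat j) + cmod (\<Sum>j=1..J. (d (n + j) - d n) / of_nat j)"
      by (simp only: norm_triangle_ineq4)
    also have "\<dots> \<le> \<epsilon> + (\<Sum>j=1..J. \<epsilon> / ln (real n) / real j)"
    proof (rule add_mono)
      show "cmod (\<Sum>j=1..J. d (n + j) / of_nat j) \<le> \<epsilon>" using elim(2) \<open>J \<le> n\<close> by blast
      show "cmod (\<Sum>j=1..J. (d (n + j) - d n) / of_nat j) \<le> (\<Sum>j=1..J. \<epsilon> / ln (real n) / real j)"
      proof (rule order_trans[OF norm_sum], rule sum_mono)
        fix j assume j: "j \<in> {1..J}"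
        have "cmod (d (n + j) - d n) \<le> \<epsilon> / ln (real n)" using close[of j] j lnp by (simp add: field_simps)
        then show "cmod ((d (n + j) - d n) / of_nat j) \<le> \<epsilon> / ln (real n) / real j"
          unfolding norm_divide norm_of_nat by (rule divide_right_mono) simp
      qed
    qed
    also have "(\<Sum>j=1..J. \<epsilon> / ln (real n) / real j) = h * (\<epsilon> / ln (real n))"
      by (simp add: h_def harm_def sum_distrib_left sum_distrib_right divide_inverse mult_ac)
    finally have main: "h * cmod (d n) \<le> \<epsilon> + h * (\<epsilon> / ln (real n))"
      by (simp add: norm_mult hpos[THEN less_imp_le])
    have "cmod (d n) * ln (real n) = (h * cmod (d n)) * ln (real n) / h"
      using hpos by simp
    also have "\<dots> \<le> (\<epsilon> + h * (\<epsilon> / ln (real n))) * ln (real n) / h"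
      using main lnp hpos by (intro divide_right_mono mult_right_mono) auto
    also have "\<dots> = \<epsilon> * (ln (real n) / h) + \<epsilon>"
      using lnp hpos by (simp add: field_simps)
    also have "\<dots> \<le> \<epsilon> * 2 + \<epsilon>"
      using harm \<epsilon> hpos by (intro add_right_mono mult_left_mono) (auto simp: divide_le_eq)
    also have "\<dots> < e" using \<open>e > 0\<close> by (simp add: \<epsilon>_def)
    finally show ?case .
  qed
qed

section \<open>Decay of coefficients and convergence of partial sums\<close>

lemma partial_sum_difference:
  assumes "n \<le> m"
  shows "fourier_partial_sum m f x - fourier_partial_sum n f x =
    (\<Sum>k=Suc n..m. fourier_coeff f (int k) * cis (real k * x)) +
    (\<Sum>k=Suc n..m. fourier_coeff f (- int k) * cis (- (real k * x)))"
  using assms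
proof (induction m rule: dec_induct)
  case (step m)
  have "{- int (Suc m)..int (Suc m)} = insert (int (Suc m)) (insert (- int (Suc m)) {- int m..int m})"
    by auto
  then have "fourier_partial_sum (Suc m) f x = fourier_partial_sum m f x
      + fourier_coeff f (int (Suc m)) * cis (real (Suc m) * x)
      + fourier_coeff f (- int (Suc m)) * cis (- (real (Suc m) * x))"
    unfolding fourier_partial_sum_eq by (simp del: of_nat_Suc add: algebra_simps)
  then show ?case using step.IH step.hyps by (simp del: of_nat_Suc add: algebra_simps)
qed simp

text \<open>
  The coefficients of \<open>g\<close> vanish on \<open>[-n, n]\<close>, so of the two frequencies \<open>n + j\<close> and \<open>n - j\<close> that
  the sine pairing sees only the first contributes; likewise around \<open>-n\<close>. The condition
  \<open>J \<le> n\<close> keeps the other frequency inside \<open>[-n, n]\<close>.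
\<close>

lemma coeff_tail_sums_bounded:
  assumes f: "integrable circ f" and "J \<le> n"
  defines "g \<equiv> (\<lambda>x. f x - fourier_partial_sum n f x)"
  shows "cmod (\<Sum>j=1..J. fourier_coeff f (int (n + j)) / of_nat j) \<le> L_norm g"
    and "cmod (\<Sum>j=1..J. fourier_coeff f (- int (n + j)) / of_nat j) \<le> L_norm g"
proof -
  have gi: "integrable circ g" using f by (simp add: g_def)
  have gc: "fourier_coeff g k = (if k \<in> {-int n..int n} then 0 else fourier_coeff f k)" for k
    using f by (simp add: g_def fourier_coeff_diff fourier_coeff_partial_sum)
  have "(\<Sum>j=1..J. fourier_coeff f (int (n + j)) / of_nat j)
      = (\<Sum>j=1..J. (fourier_coeff g (int n + int j) - fourier_coeff g (int n - int j)) / of_nat j)"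
    using \<open>J \<le> n\<close> by (intro sum.cong) (auto simp: gc)
  then show "cmod (\<Sum>j=1..J. fourier_coeff f (int (n + j)) / of_nat j) \<le> L_norm g"
    using sine_pairing[OF gi, where m="int n" and J=J] by simp
  have "(\<Sum>j=1..J. fourier_coeff f (- int (n + j)) / of_nat j)
      = - (\<Sum>j=1..J. (fourier_coeff g (- int n + int j) - fourier_coeff g (- int n - int j)) / of_nat j)"
    unfolding sum_negf[symmetric]
    using \<open>J \<le> n\<close> by (intro sum.cong) (auto simp: gc)
  then show "cmod (\<Sum>j=1..J. fourier_coeff f (- int (n + j)) / of_nat j) \<le> L_norm g"
    using sine_pairing[OF gi, where m="- int n" and J=J] by (simp only: norm_minus_cancel)
qed

text \<open>
  Both halves of \<open>S m - S n\<close> are blocks of exponentials, to which summation by parts applies. As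
  \<open>b = a - d\<close>, the variation of \<open>b\<close> is at most the sum of those of \<open>a\<close> and \<open>d\<close>.
\<close>

lemma partial_sums_slow:
  fixes f :: "real \<Rightarrow> complex"
  defines "a \<equiv> (\<lambda>n. fourier_coeff f (int n))" and "b \<equiv> (\<lambda>n. fourier_coeff f (- int n))"
  assumes av: "(\<lambda>m. ln (real m) * (\<Sum>k=m..2*m. cmod (a (Suc k) - a k))) \<longlonglongrightarrow> 0"
    and a0: "log_null a" and b0: "log_null b" and d: "slowly_varying (\<lambda>n. a n - b n)"
    and e: "e > 0"
  shows "\<exists>\<mu>>1. \<mu> \<le> 2 \<and> (\<forall>\<^sub>F n in sequentially. \<forall>m. n \<le> m \<and> real m \<le> \<mu> * real n \<longrightarrow>
    L_norm (\<lambda>x. fourier_partial_sum m f x - fourier_partial_sum n f x) \<le> e)"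
proof -
  \<comment> \<open>4 pi from the block estimate, 2 from ln (2 + m) \<le> 2 ln n, and five small terms below.\<close>
  define \<epsilon> where "\<epsilon> = e / (40 * pi)"
  have \<epsilon>: "\<epsilon> > 0" using e by (simp add: \<epsilon>_def)
  obtain \<mu> where \<mu>: "\<mu> > 1" "\<mu> \<le> 2" and
    ev: "\<forall>\<^sub>F n in sequentially. (\<Sum>k=n..nat \<lfloor>\<mu> * real n\<rfloor>. cmod (a (Suc k) - b (Suc k) - (a k - b k)) * ln (real k)) \<le> \<epsilon>"
    using d \<epsilon> unfolding slowly_varying_def by blast
  have ev_a: "\<forall>\<^sub>F n in sequentially. ln (real n) * (\<Sum>k=n..2*n. cmod (a (Suc k) - a k)) < \<epsilon>"
    by (rule order_tendstoD(2)[OF av \<epsilon>])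
  obtain N where N: "\<And>n. n \<ge> N \<Longrightarrow> cmod (a n) * ln (real n) < \<epsilon>" "\<And>n. n \<ge> N \<Longrightarrow> cmod (b n) * ln (real n) < \<epsilon>"
  proof -
    have "\<forall>\<^sub>F n in sequentially. cmod (a n) * ln (real n) < \<epsilon> \<and> cmod (b n) * ln (real n) < \<epsilon>"
      using a0 b0 order_tendstoD(2) \<epsilon> unfolding log_null_def by (intro eventually_conj) blast+
    then show ?thesis using that by (auto simp: eventually_sequentially)
  qed
  have big: "\<forall>\<^sub>F n in sequentially. n \<ge> max 3 N" by (rule eventually_ge_at_top)
  have "\<forall>\<^sub>F n in sequentially. \<forall>m. n \<le> m \<and> real m \<le> \<mu> * real n \<longrightarrow>
    L_norm (\<lambda>x. fourier_partial_sum m f x - fourier_partial_sum n f x) \<le> e"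
    using ev ev_a big
  proof eventually_elim
    case (elim n)
    show ?case
    proof (intro allI impI, elim conjE)
      fix m assume "n \<le> m" and mn: "real m \<le> \<mu> * real n"
      have n: "n \<ge> 3" "n \<ge> N" using elim by auto
      then have lnp: "ln (real n) > 0" by simp
      have "\<mu> * real n \<le> 2 * real n" using \<mu> by (intro mult_right_mono) auto
      then have m2: "m \<le> 2 * n" using mn by linarith
      show "L_norm (\<lambda>x. fourier_partial_sum m f x - fourier_partial_sum n f x) \<le> e"
      proof (cases "m = n")
        case True
        then show ?thesis using e by (simp add: L_norm_eq)
      next
        case False
        then have nm: "Suc n \<le> m" using \<open>n \<le> m\<close> by simp
        define Va where "Va = (\<Sum>k=Suc n..<m. cmod (a (Suc k) - a k))"
        define Vb where "Vb = (\<Sum>k=Suc n..<m. cmod (b (Suc k) - b k))"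
        define Vd where "Vd = (\<Sum>k=Suc n..<m. cmod (a (Suc k) - b (Suc k) - (a k - b k)))"
        have Va0: "Va \<ge> 0" "Vb \<ge> 0" by (simp_all add: Va_def Vb_def sum_nonneg)
        have "ln (real n) * Va \<le> ln (real n) * (\<Sum>k=n..2*n. cmod (a (Suc k) - a k))"
          unfolding Va_def using lnp m2 by (intro mult_left_mono sum_mono2) auto
        then have Va: "ln (real n) * Va \<le> \<epsilon>" using elim by linarith
        have "ln (real n) * Vd \<le> (\<Sum>k=Suc n..<m. cmod (a (Suc k) - b (Suc k) - (a k - b k)) * ln (real k))"
          unfolding Vd_def sum_distrib_left using n
          by (intro sum_mono) (auto simp: mult.commute intro!: mult_right_mono)
        also have "\<dots> \<le> (\<Sum>k=n..nat \<lfloor>\<mu> * real n\<rfloor>. cmod (a (Suc k) - b (Suc k) - (a k - b k)) * ln (real k))"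
        proof (rule sum_mono2)
          have "m \<le> nat \<lfloor>\<mu> * real n\<rfloor>" using mn by linarith
          then show "{Suc n..<m} \<subseteq> {n..nat \<lfloor>\<mu> * real n\<rfloor>}" by auto
        qed (use n in auto)
        finally have Vd: "ln (real n) * Vd \<le> \<epsilon>" using elim by linarith
        have "Vb \<le> Va + Vd"
          unfolding Va_def Vb_def Vd_def sum.distrib[symmetric]
        proof (rule sum_mono)
          fix k
          have "b (Suc k) - b k = (a (Suc k) - a k) - (a (Suc k) - b (Suc k) - (a k - b k))" by simp
          then show "cmod (b (Suc k) - b k) \<le> cmod (a (Suc k) - a k) + cmod (a (Suc k) - b (Suc k) - (a k - b k))"
            by (metis norm_triangle_ineq4)
        qed
        then have "ln (real n) * Vb \<le> ln (real n) * (Va + Vd)" using lnp by (intro mult_left_mono) auto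
        then have Vb: "ln (real n) * Vb \<le> 2 * \<epsilon>" using Va Vd by (simp add: distrib_left)
        have small: "ln (real n) * cmod z \<le> \<epsilon>" if "cmod z * ln (real m) < \<epsilon>" for z
        proof -
          have "ln (real n) * cmod z \<le> ln (real m) * cmod z"
            using n nm by (intro mult_right_mono) auto
          then show ?thesis using that by (simp add: mult.commute)
        qed
        have am: "ln (real n) * cmod (a m) \<le> \<epsilon>" "ln (real n) * cmod (b m) \<le> \<epsilon>"
          using N[of m] n nm by (auto intro!: small)
        have lnm: "ln (2 + real m) \<le> 2 * ln (real n)"
        proof -
          have "2 + real m \<le> 2 + 2 * real n" using m2 by linarith
          also have "\<dots> \<le> real n * real n"
          proof -
            have "3 * real n \<le> real n * real n" using n by (intro mult_right_mono) auto
            then show ?thesis using n by linarith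
          qed
          finally have "ln (2 + real m) \<le> ln (real n * real n)" by (intro ln_mono) auto
          also have "\<dots> = 2 * ln (real n)" using n by (simp add: ln_mult_pos)
          finally show ?thesis .
        qed
        have "L_norm (\<lambda>x. fourier_partial_sum m f x - fourier_partial_sum n f x)
          \<le> L_norm (\<lambda>x. \<Sum>k=Suc n..m. a k * cis (real k * x)) + L_norm (\<lambda>x. \<Sum>k=Suc n..m. b k * cis (- (real k * x)))"
          unfolding partial_sum_difference[OF \<open>n \<le> m\<close>] a_def b_def
          using integrable_cis[of "- real k" for k]
          by (intro L_norm_triangle Bochner_Integration.integrable_sum integrable_mult_right) auto
        also have "\<dots> \<le> 4 * pi * ln (2 + real m) * (cmod (a m) + Va) + 4 * pi * ln (2 + real m) * (cmod (b m) + Vb)"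
          unfolding Va_def Vb_def by (intro add_mono block_L1 block_L1_minus nm)
        also have "\<dots> = 4 * pi * (ln (2 + real m) * (cmod (a m) + Va + cmod (b m) + Vb))"
          by (simp add: algebra_simps)
        also have "\<dots> \<le> 4 * pi * (2 * ln (real n) * (cmod (a m) + Va + cmod (b m) + Vb))"
          using Va0 by (intro mult_left_mono mult_right_mono lnm) auto
        also have "\<dots> = 8 * pi * (ln (real n) * cmod (a m) + ln (real n) * Va + ln (real n) * cmod (b m) + ln (real n) * Vb)"
          by (simp add: algebra_simps)
        also have "\<dots> \<le> 8 * pi * (\<epsilon> + \<epsilon> + \<epsilon> + 2 * \<epsilon>)"
          by (intro mult_left_mono add_mono am Va Vb) auto
        also have "\<dots> = e" by (simp add: \<epsilon>_def)
        finally show ?thesis .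
      qed
    qed
  qed
  then show ?thesis using \<mu> by blast
qed

text \<open>
  \<open>f - S n\<close> is the average over \<open>n \<le> m < M\<close> of \<open>f - S m\<close>, which is small by
  \<open>vallee_poussin_means\<close>, plus that of \<open>S m - S n\<close>, which is small term by term.
\<close>

lemma L1_convergence_of_slow_partial_sums:
  assumes f: "integrable circ f"
    and slow: "\<And>e. e > 0 \<Longrightarrow> \<exists>\<mu>>1. \<mu> \<le> 2 \<and> (\<forall>\<^sub>F n in sequentially. \<forall>m. n \<le> m \<and> real m \<le> \<mu> * real n \<longrightarrow>
       L_norm (\<lambda>x. fourier_partial_sum m f x - fourier_partial_sum n f x) \<le> e)"
  shows "(\<lambda>n. L_norm (\<lambda>x. f x - fourier_partial_sum n f x)) \<longlonglongrightarrow> 0"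
proof (rule order_tendstoI)
  fix e :: real assume "e < 0"
  then show "\<forall>\<^sub>F n in sequentially. e < L_norm (\<lambda>x. f x - fourier_partial_sum n f x)"
    by (intro always_eventually allI less_le_trans[OF _ L_norm_nonneg])
next
  fix e :: real assume e: "e > 0"
  obtain \<mu> where \<mu>: "\<mu> > 1" "\<mu> \<le> 2" and ev: "\<forall>\<^sub>F n in sequentially. \<forall>m. n \<le> m \<and> real m \<le> \<mu> * real n \<longrightarrow>
       L_norm (\<lambda>x. fourier_partial_sum m f x - fourier_partial_sum n f x) \<le> e / 3"
    using slow[of "e / 3"] e by auto
  \<comment> \<open>With M = \<mu> n rounded down, M + n \<le> 3 n and M - n \<ge> (\<mu> - 1) n / 2.\<close>
  define K where "K = 6 / (\<mu> - 1)"
  obtain n0 where "\<forall>n\<ge>n0. \<forall>M>n. real (M + n) \<le> K * real (M - n) \<longrightarrow>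
    L_norm (\<lambda>x. \<Sum>m=n..<M. f x - fourier_partial_sum m f x) \<le> e / 3 * real (M - n)"
    using vallee_poussin_means[OF f, of "e / 3" K] e by auto
  then have n0: "\<And>n M. n \<ge> n0 \<Longrightarrow> M > n \<Longrightarrow> real (M + n) \<le> K * real (M - n) \<Longrightarrow>
    L_norm (\<lambda>x. \<Sum>m=n..<M. f x - fourier_partial_sum m f x) \<le> e / 3 * real (M - n)" by blast
  have big: "\<forall>\<^sub>F n in sequentially. real n \<ge> 4 / (\<mu> - 1)"
    using filterlim_real_sequentially unfolding filterlim_at_top by blast
  have big': "\<forall>\<^sub>F n in sequentially. n \<ge> n0" by (rule eventually_ge_at_top)
  show "\<forall>\<^sub>F n in sequentially. L_norm (\<lambda>x. f x - fourier_partial_sum n f x) < e"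
    using ev big big'
  proof eventually_elim
    case (elim n)
    define M where "M = nat \<lfloor>\<mu> * real n\<rfloor>"
    have big: "(\<mu> - 1) * real n \<ge> 4" using elim(2) \<mu> by (simp add: field_simps)
    have M1: "real M \<le> \<mu> * real n" using \<mu> by (simp add: M_def)
    have M2: "real M > \<mu> * real n - 1" using \<mu> unfolding M_def by linarith
    have "\<mu> * real n = real n + (\<mu> - 1) * real n" by (simp add: algebra_simps)
    then have M3: "real M - real n \<ge> (\<mu> - 1) * real n / 2" using M2 big by linarith
    then have "real M > real n" using big by linarith
    then have "M > n" by simp
    have "\<mu> * real n \<le> 2 * real n" using \<mu> by (intro mult_right_mono) auto
    then have "real (M + n) \<le> 3 * real n" using M1 by simp
    also have "\<dots> = K * ((\<mu> - 1) * real n / 2)" using \<mu> by (simp add: K_def)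
    also have "\<dots> \<le> K * real (M - n)"
      using M3 \<open>M > n\<close> \<mu> by (intro mult_left_mono) (auto simp: K_def of_nat_diff)
    finally have vp: "L_norm (\<lambda>x. \<Sum>m=n..<M. f x - fourier_partial_sum m f x) \<le> e / 3 * real (M - n)"
      using n0 elim(3) \<open>M > n\<close> by blast
    have fi: "integrable circ (\<lambda>x. f x - fourier_partial_sum m f x)" for m using f by simp
    have di: "integrable circ (\<lambda>x. fourier_partial_sum m f x - fourier_partial_sum n f x)" for m by simp
    have "real (M - n) * L_norm (\<lambda>x. f x - fourier_partial_sum n f x)
        = L_norm (\<lambda>x. of_nat (M - n) * (f x - fourier_partial_sum n f x))"
      by (simp only: L_norm_cmult norm_of_nat)
    also have "\<dots> = L_norm (\<lambda>x. (\<Sum>m=n..<M. f x - fourier_partial_sum m f x)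
          + (\<Sum>m=n..<M. fourier_partial_sum m f x - fourier_partial_sum n f x))"
      by (simp only: sum.distrib[symmetric]) simp
    also have "\<dots> \<le> L_norm (\<lambda>x. \<Sum>m=n..<M. f x - fourier_partial_sum m f x)
         + L_norm (\<lambda>x. \<Sum>m=n..<M. fourier_partial_sum m f x - fourier_partial_sum n f x)"
      by (intro L_norm_triangle Bochner_Integration.integrable_sum fi di)
    also have "\<dots> \<le> e / 3 * real (M - n) + (\<Sum>m=n..<M. L_norm (\<lambda>x. fourier_partial_sum m f x - fourier_partial_sum n f x))"
      by (intro add_mono vp L_norm_sum di)
    also have "\<dots> \<le> e / 3 * real (M - n) + (\<Sum>m=n..<M. e / 3)"
    proof (intro add_left_mono sum_mono)
      fix m assume m: "m \<in> {n..<M}"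
      then have "real m \<le> \<mu> * real n" using M1 by (auto intro: order_trans)
      then show "L_norm (\<lambda>x. fourier_partial_sum m f x - fourier_partial_sum n f x) \<le> e / 3"
        using elim(1) m by auto
    qed
    also have "\<dots> = real (M - n) * (2 * e / 3)" by simp
    finally have "L_norm (\<lambda>x. f x - fourier_partial_sum n f x) \<le> 2 * e / 3"
      using \<open>M > n\<close> by (subst (asm) mult_le_cancel_left_pos) auto
    then show ?case using e by linarith
  qed
qed

theorem theorem1:
  fixes f :: "real \<Rightarrow> complex"
  assumes "f \<in> L_2pi"
    and "(\<lambda>n::nat. fourier_coeff f (int n)) \<in> MVBVS"
    and "((\<lambda>\<mu>::real. limsup (\<lambda>n::nat. ereal (\<Sum>k=n..nat \<lfloor>\<mu> * real n\<rfloor>.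
             cmod ((fourier_coeff f (int k + 1) - fourier_coeff f (int k))
                   - (fourier_coeff f (- int k - 1) - fourier_coeff f (- int k)))
             * ln (real k)))) \<longlongrightarrow> 0) (at_right 1)"
  shows "((\<lambda>n::nat. L_norm (\<lambda>x. f x - fourier_partial_sum n f x)) \<longlonglongrightarrow> 0)
     \<longleftrightarrow> ((\<lambda>n::int. fourier_coeff f n * of_real (ln (real_of_int \<bar>n\<bar>)))
            \<longlongrightarrow> 0) (filtercomap abs at_top)"
proof -
  define a where "a n = fourier_coeff f (int n)" for n
  define b where "b n = fourier_coeff f (- int n)" for n
  have f: "integrable circ f" by (rule L_2pi_integrable[OF assms(1)])
  have a: "a \<in> MVBVS" using assms(2) by (simp add: a_def[abs_def])
  have d: "slowly_varying (\<lambda>n. a n - b n)"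
  proof (rule slowly_varying_of_limsup)
    have "cmod ((fourier_coeff f (int k + 1) - fourier_coeff f (int k))
                   - (fourier_coeff f (- int k - 1) - fourier_coeff f (- int k)))
       = cmod (a (Suc k) - b (Suc k) - (a k - b k))" for k
    proof -
      have "int (Suc k) = int k + 1" "- int (Suc k) = - int k - 1" by simp_all
      then show ?thesis unfolding a_def b_def by (simp only:) (simp add: algebra_simps)
    qed
    then show "((\<lambda>\<mu>::real. limsup (\<lambda>n::nat. ereal (\<Sum>k=n..nat \<lfloor>\<mu> * real n\<rfloor>.
             cmod (a (Suc k) - b (Suc k) - (a k - b k)) * ln (real k)))) \<longlongrightarrow> 0) (at_right 1)"
      using assms(3) by simp
  qed
  show ?thesis
    unfolding tendsto_int_iff_log_null a_def[symmetric] b_def[symmetric]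
  proof
    assume conv: "(\<lambda>n. L_norm (\<lambda>x. f x - fourier_partial_sum n f x)) \<longlonglongrightarrow> 0"
    obtain \<theta> where \<theta>: "0 \<le> \<theta>" "\<theta> < pi / 2" "\<And>n. a n \<in> sector \<theta>"
      using a unfolding MVBVS_def by blast
    have "(\<lambda>n. cmod (\<Sum>j=1..n. a (n + j) / of_nat j)) \<longlonglongrightarrow> 0"
      by (rule Lim_null_comparison[OF _ conv])
         (auto intro!: always_eventually coeff_tail_sums_bounded(1)[OF f order_refl, unfolded One_nat_def] simp: a_def simp del: of_nat_add)
    then have a0: "log_null a"
      using MVBVS_log_null[OF a small_log_mass_of_sector[OF \<theta>]] by simp
    have d0: "log_null (\<lambda>n. a n - b n)"
    proof (rule slowly_varying_log_null[OF d])
      fix \<epsilon> :: real assume "\<epsilon> > 0"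
      then have "\<forall>\<^sub>F n in sequentially. L_norm (\<lambda>x. f x - fourier_partial_sum n f x) < \<epsilon> / 2"
        by (intro order_tendstoD(2)[OF conv]) simp
      then show "\<forall>\<^sub>F n in sequentially. \<forall>J\<le>n. cmod (\<Sum>j=1..J. (a (n + j) - b (n + j)) / of_nat j) \<le> \<epsilon>"
      proof eventually_elim
        case (elim n)
        show ?case
        proof (intro allI impI)
          fix J assume "J \<le> n"
          have "cmod (\<Sum>j=1..J. (a (n + j) - b (n + j)) / of_nat j)
             = cmod ((\<Sum>j=1..J. a (n + j) / of_nat j) - (\<Sum>j=1..J. b (n + j) / of_nat j))"
            by (simp add: diff_divide_distrib sum_subtractf)
          also have "\<dots> \<le> cmod (\<Sum>j=1..J. a (n + j) / of_nat j) + cmod (\<Sum>j=1..J. b (n + j) / of_nat j)"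
            by (rule norm_triangle_ineq4)
          also have "\<dots> \<le> \<epsilon> / 2 + \<epsilon> / 2"
            unfolding a_def b_def
            using coeff_tail_sums_bounded[OF f \<open>J \<le> n\<close>] elim by (intro add_mono) linarith+
          finally show "cmod (\<Sum>j=1..J. (a (n + j) - b (n + j)) / of_nat j) \<le> \<epsilon>" by simp
        qed
      qed
    qed
    have "log_null b"
      unfolding log_null_def
    proof (rule Lim_null_comparison)
      show "(\<lambda>n. cmod (a n) * ln (real n) + cmod (a n - b n) * ln (real n)) \<longlonglongrightarrow> 0"
        using tendsto_add[OF a0[unfolded log_null_def] d0[unfolded log_null_def]] by simp
      show "\<forall>\<^sub>F n in sequentially. norm (cmod (b n) * ln (real n)) \<le> cmod (a n) * ln (real n) + cmod (a n - b n) * ln (real n)"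
      proof (rule eventually_sequentiallyI[of 1])
        fix n :: nat assume n: "n \<ge> 1"
        have "cmod (b n) \<le> cmod (a n) + cmod (a n - b n)"
          using norm_triangle_ineq4[of "a n" "a n - b n"] by simp
        then have "cmod (b n) * ln (real n) \<le> (cmod (a n) + cmod (a n - b n)) * ln (real n)"
          using n by (intro mult_right_mono) auto
        then show "norm (cmod (b n) * ln (real n)) \<le> cmod (a n) * ln (real n) + cmod (a n - b n) * ln (real n)"
          using n by (simp add: distrib_right)
      qed
    qed
    with a0 show "log_null (\<lambda>n. a n) \<and> log_null (\<lambda>n. b n)" by simp
  next
    assume "log_null (\<lambda>n. a n) \<and> log_null (\<lambda>n. b n)"
    then have a0: "log_null a" and b0: "log_null b" by simp_all
    have "(\<lambda>m. ln (real m) * (\<Sum>k=m..2*m. cmod (a (Suc k) - a k))) \<longlonglongrightarrow> 0"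
      by (rule MVBVS_log_variation[OF a small_log_mass_of_log_null[OF a0]])
    then show "(\<lambda>n. L_norm (\<lambda>x. f x - fourier_partial_sum n f x)) \<longlonglongrightarrow> 0"
      using a0 b0 d
      by (intro L1_convergence_of_slow_partial_sums[OF f] partial_sums_slow) (simp_all add: a_def[abs_def] b_def[abs_def])
  qed
qed

end
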